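(* There exists a universal constant $C>0$ such that the following holds. Let $K\subset\mathbb{R}^n$ be a closed convex set, $\mu_0\in K$, $h\sim\mathcal{N}(0,I_n)$, and let $H\in\{\mathrm{err},\mathrm{lrt},\mathrm{dof}\}$ be one of the processes defined in the context. Then for any $0<\epsilon_0<M_0$ and $t\ge1$, $$\mathbb{P}\Big[|H(\sigma)-\mathbb{E}H(\sigma)|\le C\big(\sigma\,(\mathbb{E}\,\mathrm{err}(\sigma))^{1/2}\sqrt t+\sigma^2t\big),\ \ \forall\sigma\in[\epsilon_0,M_0]\Big]$$ $$\ge1-Ce^{-t/C}\,(1+\delta_{T_K(\mu_0)})\,\log_+(M_0/\epsilon_0)\ \ge\ 1-2Ce^{-t/C}\,n\log_+(M_0/\epsilon_0).$$
   Context: $\Pi_K$ is the metric projection onto $K$; $\|\cdot\|$ is the Euclidean norm. For $\sigma\ge0$: $\hat\mu_K^{\mathrm{seq}}(\sigma)=\Pi_K(\mu_0+\sigma h)$, $\mathrm{err}(\sigma)=\|\hat\mu_K^{\mathrm{seq}}(\sigma)-\mu_0\|^2$, $\mathrm{lrt}(\sigma)=\|\sigma h\|^2-\|\mu_0+\sigma h-\hat\mu_K^{\mathrm{seq}}(\sigma)\|^2$, $\mathrm{dof}(\sigma)=\langle\hat\mu_K^{\mathrm{seq}}(\sigma)-\mu_0,\sigma h\rangle$ (all driven by the same $h$). $T_K(\mu_0)=\mathrm{cl}\{\alpha(\nu-\mu_0):\alpha\ge0,\nu\in K\}$, and $\delta_T=\mathbb{E}\|\Pi_T(h)\|^2$ for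 a closed convex cone $T$. $\log_+(a)=\max\{1,\log a\}$. *)

theory Defs
  imports "HOL-Probability.Probability"
begin

(* The constant in the theorem is uniform in the dimension n, so n has to be a term-level
   variable.  A vector of R^n is an element of {..<n} \<rightarrow>\<^sub>E UNIV, i.e. a function that is
   undefined outside {..<n}; this is also the sample space of the product measure below. *)

abbreviation euclid_top :: "nat \<Rightarrow> (nat \<Rightarrow> real) topology" where
  "euclid_top n \<equiv> product_topology (\<lambda>_. euclideanreal) {..<n}"

definition vadd :: "nat \<Rightarrow> (nat \<Rightarrow> real) \<Rightarrow> (nat \<Rightarrow> real) \<Rightarrow> (nat \<Rightarrow> real)" where
  "vadd n x y = (\<lambda>i\<in>{..<n}. x i + y i)"

definition vsub :: "nat \<Rightarrow> (nat \<Rightarrow> real) \<Rightarrow> (nat \<Rightarrow> real) \<Rightarrow> (nat \<Rightarrow> real)" where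
  "vsub n x y = (\<lambda>i\<in>{..<n}. x i - y i)"

definition vscale :: "nat \<Rightarrow> real \<Rightarrow> (nat \<Rightarrow> real) \<Rightarrow> (nat \<Rightarrow> real)" where
  "vscale n a x = (\<lambda>i\<in>{..<n}. a * x i)"

definition vinner :: "nat \<Rightarrow> (nat \<Rightarrow> real) \<Rightarrow> (nat \<Rightarrow> real) \<Rightarrow> real" where
  "vinner n x y = (\<Sum>i<n. x i * y i)"

abbreviation vnorm :: "nat \<Rightarrow> (nat \<Rightarrow> real) \<Rightarrow> real" where
  "vnorm n x \<equiv> L2_set x {..<n}"

definition vconvex :: "nat \<Rightarrow> (nat \<Rightarrow> real) set \<Rightarrow> bool" where
  "vconvex n K \<longleftrightarrow>
     (\<forall>x\<in>K. \<forall>y\<in>K. \<forall>u\<ge>0. \<forall>v\<ge>0. u + v = 1 \<longrightarrow> vadd n (vscale n u x) (vscale n v y) \<in> K)"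

(* Only meaningful for nonempty closed convex K, where the minimiser exists and is unique. *)
definition metric_proj :: "nat \<Rightarrow> (nat \<Rightarrow> real) set \<Rightarrow> (nat \<Rightarrow> real) \<Rightarrow> (nat \<Rightarrow> real)" where
  "metric_proj n K x = arg_min_on (\<lambda>y. vnorm n (vsub n x y)) K"

definition std_gaussian :: "nat \<Rightarrow> (nat \<Rightarrow> real) measure" where
  "std_gaussian n = PiM {..<n} (\<lambda>_. density lborel (\<lambda>x. ennreal (std_normal_density x)))"

definition mu_hat ::
  "nat \<Rightarrow> (nat \<Rightarrow> real) set \<Rightarrow> (nat \<Rightarrow> real) \<Rightarrow> real \<Rightarrow> (nat \<Rightarrow> real) \<Rightarrow> (nat \<Rightarrow> real)" where
  "mu_hat n K \<mu>0 \<sigma> h = metric_proj n K (vadd n \<mu>0 (vscale n \<sigma> h))"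

definition err ::
  "nat \<Rightarrow> (nat \<Rightarrow> real) set \<Rightarrow> (nat \<Rightarrow> real) \<Rightarrow> real \<Rightarrow> (nat \<Rightarrow> real) \<Rightarrow> real" where
  "err n K \<mu>0 \<sigma> h = (vnorm n (vsub n (mu_hat n K \<mu>0 \<sigma> h) \<mu>0))\<^sup>2"

definition lrt ::
  "nat \<Rightarrow> (nat \<Rightarrow> real) set \<Rightarrow> (nat \<Rightarrow> real) \<Rightarrow> real \<Rightarrow> (nat \<Rightarrow> real) \<Rightarrow> real" where
  "lrt n K \<mu>0 \<sigma> h =
     (vnorm n (vscale n \<sigma> h))\<^sup>2
       - (vnorm n (vsub n (vadd n \<mu>0 (vscale n \<sigma> h)) (mu_hat n K \<mu>0 \<sigma> h)))\<^sup>2"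

definition dof ::
  "nat \<Rightarrow> (nat \<Rightarrow> real) set \<Rightarrow> (nat \<Rightarrow> real) \<Rightarrow> real \<Rightarrow> (nat \<Rightarrow> real) \<Rightarrow> real" where
  "dof n K \<mu>0 \<sigma> h = vinner n (vsub n (mu_hat n K \<mu>0 \<sigma> h) \<mu>0) (vscale n \<sigma> h)"

definition tangent_cone ::
  "nat \<Rightarrow> (nat \<Rightarrow> real) set \<Rightarrow> (nat \<Rightarrow> real) \<Rightarrow> (nat \<Rightarrow> real) set" where
  "tangent_cone n K \<mu>0 =
     euclid_top n closure_of {vscale n \<alpha> (vsub n \<nu> \<mu>0) | \<alpha> \<nu>. 0 \<le> \<alpha> \<and> \<nu> \<in> K}"

definition stat_dim :: "nat \<Rightarrow> (nat \<Rightarrow> real) set \<Rightarrow> real" where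
  "stat_dim n T = (\<integral>h. (vnorm n (metric_proj n T h))\<^sup>2 \<partial>std_gaussian n)"

definition log_plus :: "real \<Rightarrow> real" where
  "log_plus a = max 1 (ln a)"

end

theory Submission
  imports Defs
begin

text \<open>The Gaussian measure satisfies Maurey's property (tau), i.e. \<open>\<integral>u \<partial>\<gamma> * \<integral>v \<partial>\<gamma> \<le> 1\<close> whenever
  \<open>u x * v y \<le> exp (\<bar>x - y\<bar>\<^sup>2 / 4)\<close>; this follows from the Prekopa-Leindler inequality in dimension one
  and tensorizes. Taking \<open>v = exp (-F)\<close> gives a concentration inequality for \<open>F\<close> which needs neither
  smoothness nor a bounded gradient: \<open>F\<close> exceeds its mean by more than \<open>R + t\<close> with probability at most \<open>exp (-t)\<close> as soon
  as \<open>F x - F y \<le> R x + \<bar>x - y\<bar>\<^sup>2 / 4\<close>. It applies to \<open>sqrt err\<close>, which is \<open>\<sigma>\<close>-Lipschitz, with constant \<open>R\<close>,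
  and to small multiples of \<open>\<plusminus>lrt\<close>, whose gradient has norm \<open>2 \<sigma> sqrt err\<close>, with \<open>R\<close> proportional to \<open>err\<close>;
  moreover \<open>dof = (lrt + err) / 2\<close>.

  For uniformity in \<open>\<sigma>\<close>, each process \<open>H\<close> is nondecreasing while \<open>H \<sigma> / \<sigma>\<^sup>2\<close> is nonincreasing, and its mean is at
  most \<open>2 \<sigma>\<^sup>2 \<delta>\<close>. On a geometric grid of ratio \<open>exp (1 / (1 + \<delta>))\<close> consecutive means thus differ by \<open>O(\<sigma>\<^sup>2)\<close>,
  so that a union bound over the grid suffices.\<close>

section \<open>Property (tau) of the Gaussian measure\<close>

text \<open>A form of one-dimensional Brunn-Minkowski for midpoints confined to
  \<open>[-r, r]\<close>. Each set lies between its infimum and supremum, and the hypothesis keeps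
  the sum of the suprema below \<open>2 * r\<close> and the sum of the infima above
  \<open>- 2 * r\<close>.\<close>

lemma emeasure_add_le_of_abs_add_le:
  fixes A B :: "real set"
  assumes "A \<noteq> {}" "B \<noteq> {}" and sb: "\<And>s t. s \<in> A \<Longrightarrow> t \<in> B \<Longrightarrow> \<bar>s + t\<bar> \<le> 2 * r"
    and [measurable]: "A \<in> sets borel" "B \<in> sets borel"
  shows "emeasure lborel A + emeasure lborel B \<le> ennreal (4 * r)"
proof -
  obtain s0 t0 where st0: "s0 \<in> A" "t0 \<in> B" using assms by auto
  have bA: "s \<le> 2 * r - t0" "- 2 * r - t0 \<le> s" if "s \<in> A" for s
    using sb[OF that st0(2)] by auto
  have bB: "t \<le> 2 * r - s0" "- 2 * r - s0 \<le> t" if "t \<in> B" for t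
    using sb[OF st0(1) that] by auto
  have bdd: "bdd_above A" "bdd_below A" "bdd_above B" "bdd_below B"
    using bA bB by (auto intro!: bdd_aboveI bdd_belowI)
  have subA: "A \<subseteq> {Inf A..Sup A}" and subB: "B \<subseteq> {Inf B..Sup B}"
    using bdd by (auto intro: cSup_upper cInf_lower)
  have "Sup A \<le> 2 * r - t" if "t \<in> B" for t
    by (rule cSup_least[OF assms(1)]) (use sb[OF _ that] in \<open>force\<close>)
  then have "t \<le> 2 * r - Sup A" if "t \<in> B" for t using that by force
  then have sup: "Sup B \<le> 2 * r - Sup A" by (rule cSup_least[OF assms(2)])
  have "- 2 * r - t \<le> Inf A" if "t \<in> B" for t
    by (rule cInf_greatest[OF assms(1)]) (use sb[OF _ that] in \<open>force\<close>)
  then have "- 2 * r - Inf A \<le> t" if "t \<in> B" for t using that by force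
  then have inf: "- 2 * r - Inf A \<le> Inf B" by (rule cInf_greatest[OF assms(2)])
  have le: "Inf A \<le> Sup A" "Inf B \<le> Sup B" using subA subB st0 by force+
  have "emeasure lborel A + emeasure lborel B \<le> emeasure lborel {Inf A..Sup A} + emeasure lborel {Inf B..Sup B}"
    by (intro add_mono emeasure_mono subA subB) auto
  also have "\<dots> = ennreal ((Sup A - Inf A) + (Sup B - Inf B))"
    using le by (simp add: ennreal_plus)
  also have "\<dots> \<le> ennreal (4 * r)" using sup inf by (intro ennreal_leI) auto
  finally show ?thesis .
qed

text \<open>Fubini on the region under the graph, cut off at height \<open>b\<close>: the level
  integral is the integral of \<open>min b (f x)\<close>. The equality serves functions normalised
  to \<open>b = 1\<close>, the inequality the dominating Gaussian, which may exceed the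
  cutoff.\<close>

lemma nn_integral_layer_cake_bounded:
  fixes f :: "real \<Rightarrow> real"
  assumes [measurable]: "f \<in> borel_measurable borel" and f: "\<And>x. 0 \<le> f x"
  shows "(\<integral>\<^sup>+r. indicator {0<..<b} r * emeasure lborel {x. r < f x} \<partial>lborel) \<le> (\<integral>\<^sup>+x. ennreal (f x) \<partial>lborel)"
    and "(\<And>x. f x \<le> b) \<Longrightarrow>
      (\<integral>\<^sup>+x. ennreal (f x) \<partial>lborel) = (\<integral>\<^sup>+r. indicator {0<..<b} r * emeasure lborel {x. r < f x} \<partial>lborel)"
proof -
  have "(\<integral>\<^sup>+r. indicator {0<..<b} r * emeasure lborel {x. r < f x} \<partial>lborel) =
     (\<integral>\<^sup>+r. (\<integral>\<^sup>+x. indicator {0<..<b} r * indicator {x. r < f x} x \<partial>lborel) \<partial>lborel)"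
    by (subst nn_integral_cmult) auto
  also have "\<dots> = (\<integral>\<^sup>+x. (\<integral>\<^sup>+r. indicator {0<..<b} r * indicator {x. r < f x} x \<partial>lborel) \<partial>lborel)"
    by (rule lborel_pair.Fubini') measurable
  also have "\<dots> = (\<integral>\<^sup>+x. (\<integral>\<^sup>+r. indicator {0<..<min b (f x)} r \<partial>lborel) \<partial>lborel)"
    by (intro nn_integral_cong) (auto simp: indicator_def)
  finally have *: "(\<integral>\<^sup>+r. indicator {0<..<b} r * emeasure lborel {x. r < f x} \<partial>lborel) =
      (\<integral>\<^sup>+x. emeasure lborel {0<..<min b (f x)} \<partial>lborel)" by simp
  have em: "emeasure lborel {0<..<y} = ennreal y" for y :: real
    by (cases "0 \<le> y") (auto simp: ennreal_neg)
  show "(\<integral>\<^sup>+r. indicator {0<..<b} r * emeasure lborel {x. r < f x} \<partial>lborel) \<le> (\<integral>\<^sup>+x. ennreal (f x) \<partial>lborel)"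
    unfolding * em by (intro nn_integral_mono ennreal_leI) auto
  show "(\<integral>\<^sup>+x. ennreal (f x) \<partial>lborel) = (\<integral>\<^sup>+r. indicator {0<..<b} r * emeasure lborel {x. r < f x} \<partial>lborel)"
    if "\<And>x. f x \<le> b"
    unfolding * em using that by (intro nn_integral_cong) (simp add: min_absorb2)
qed

text \<open>Parallelogram identity \<open>s\<^sup>2 / 2 + t\<^sup>2 / 2 - (s - t)\<^sup>2 / 4 = ((s
  + t) / 2)\<^sup>2\<close> in the exponent. It turns the hypothesis of property (tau) into one of
  Prekopa-Leindler type, dominated by the density itself.\<close>

lemma gauss_mult_le:
  "std_normal_density s * std_normal_density t * exp ((s - t)\<^sup>2 / 4) = (std_normal_density ((s + t) / 2))\<^sup>2"
proof -
  have "exp (- s\<^sup>2 / 2) * exp (- t\<^sup>2 / 2) * exp ((s - t)\<^sup>2 / 4) = exp (- s\<^sup>2 / 2 + - t\<^sup>2 / 2 + (s - t)\<^sup>2 / 4)"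
    by (simp only: exp_add)
  also have "- s\<^sup>2 / 2 + - t\<^sup>2 / 2 + (s - t)\<^sup>2 / 4 = 2 * (- ((s + t) / 2)\<^sup>2 / 2)"
    by (simp add: power2_eq_square field_simps)
  also have "exp \<dots> = (exp (- ((s + t) / 2)\<^sup>2 / 2))\<^sup>2" by (rule exp_double)
  finally show ?thesis unfolding std_normal_density_def power_mult_distrib by (simp add: power2_eq_square mult_ac)
qed

abbreviation gauss1 :: "real measure" where
  "gauss1 \<equiv> density lborel (\<lambda>x. ennreal (std_normal_density x))"

text \<open>The density is even and decreasing in \<open>\<bar>x\<bar>\<close>; solving for
  \<open>x\<^sup>2\<close> gives the squared radius. The point \<open>z\<close> shows that the set
  is nonempty, so the radius is positive.\<close>

lemma superlevel_std_normal:
  assumes "0 < c" "0 < r" "r < c * std_normal_density z"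
  shows "\<exists>\<kappa>>0. {x. r < c * std_normal_density x} = {-\<kappa><..<\<kappa>}"
proof -
  define k where "k = 2 * ln (c / (r * sqrt (2 * pi)))"
  have iff: "r < c * std_normal_density x \<longleftrightarrow> x\<^sup>2 < k" for x
  proof -
    define q where "q = c / (r * sqrt (2 * pi))"
    have q: "0 < q" and c: "c = q * (r * sqrt (2 * pi))" unfolding q_def using assms by auto
    have "c * std_normal_density x = q * r * exp (- (x\<^sup>2 / 2))"
      unfolding std_normal_density_def c by simp
    also have "\<dots> = r * (q / exp (x\<^sup>2 / 2))" by (simp add: exp_minus inverse_eq_divide)
    finally have "r < c * std_normal_density x \<longleftrightarrow> exp (x\<^sup>2 / 2) < q"
      using \<open>0 < r\<close> by (simp add: less_divide_eq)
    also have "\<dots> \<longleftrightarrow> x\<^sup>2 / 2 < ln q"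
      using q by (metis exp_less_cancel_iff exp_ln)
    also have "\<dots> \<longleftrightarrow> x\<^sup>2 < k" unfolding k_def q_def by linarith
    finally show ?thesis .
  qed
  have k: "0 < k" using iff[of z] assms(3) by (smt (verit) zero_le_power2)
  have "x\<^sup>2 < k \<longleftrightarrow> - sqrt k < x \<and> x < sqrt k" for x
    using real_sqrt_less_iff[of "x\<^sup>2" k] by auto
  then have "{x. r < c * std_normal_density x} = {- sqrt k<..<sqrt k}"
    by (intro set_eqI) (simp only: iff mem_Collect_eq greaterThanLessThan_iff)
  then show ?thesis using k by (intro exI[of _ "sqrt k"]) simp
qed

text \<open>The superlevel sets of the dominating function are intervals, so that the Brunn-Minkowski
  inequality reduces to an inequality between diameters.\<close>

lemma gauss_PL_normalised:
  fixes a b :: "real \<Rightarrow> real"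
  assumes [measurable]: "a \<in> borel_measurable borel" "b \<in> borel_measurable borel"
    and a: "\<And>s. 0 \<le> a s" "\<And>s. a s \<le> 1" "\<And>r. r < 1 \<Longrightarrow> \<exists>s. r < a s"
    and b: "\<And>s. 0 \<le> b s" "\<And>s. b s \<le> 1" "\<And>r. r < 1 \<Longrightarrow> \<exists>s. r < b s"
    and c: "0 < c" and ab: "\<And>s t. a s * b t \<le> (c * std_normal_density ((s + t) / 2))\<^sup>2"
  shows "(\<integral>\<^sup>+s. ennreal (a s) \<partial>lborel) + (\<integral>\<^sup>+s. ennreal (b s) \<partial>lborel) \<le> ennreal (2 * c)"
proof -
  let ?w = "\<lambda>z. c * std_normal_density z"
  have key: "emeasure lborel {s. r < a s} + emeasure lborel {s. r < b s} \<le> 2 * emeasure lborel {z. r < ?w z}"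
    if r: "0 < r" "r < 1" for r
  proof -
    have w: "r < ?w ((s + t) / 2)" if "r < a s" "r < b t" for s t
    proof (rule power_less_imp_less_base)
      have "r\<^sup>2 < a s * b t" using that r by (simp add: power2_eq_square mult_strict_mono)
      also have "\<dots> \<le> (?w ((s + t) / 2))\<^sup>2" by (rule ab)
      finally show "r\<^sup>2 < (?w ((s + t) / 2))\<^sup>2" .
      show "0 \<le> ?w ((s + t) / 2)" using c by simp
    qed
    \<comment> \<open>Both suprema equal 1, so both superlevel sets are nonempty at each level below
      1, as the diameter bound requires.\<close>
    obtain s0 t0 where st0: "r < a s0" "r < b t0" using a(3) b(3) r by metis
    obtain k where k: "k > 0" "{x. r < ?w x} = {-k<..<k}"
      using superlevel_std_normal[OF c r(1) w[OF st0]] by auto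
    have "emeasure lborel {s. r < a s} + emeasure lborel {s. r < b s} \<le> ennreal (4 * k)"
    proof (rule emeasure_add_le_of_abs_add_le)
      show "\<bar>s + t\<bar> \<le> 2 * k" if "s \<in> {s. r < a s}" "t \<in> {s. r < b s}" for s t
      proof -
        have "(s + t) / 2 \<in> {x. r < ?w x}" using w[of s t] that by simp
        then show ?thesis unfolding k(2) by auto
      qed
    qed (use st0 in auto)
    also have "\<dots> = 2 * emeasure lborel {z. r < ?w z}"
      unfolding k(2) using k(1) by (simp add: ennreal_mult'[of 2, simplified, symmetric] flip: ennreal_numeral ennreal_mult')
    finally show ?thesis .
  qed
  have "(\<integral>\<^sup>+s. ennreal (a s) \<partial>lborel) + (\<integral>\<^sup>+s. ennreal (b s) \<partial>lborel) =
     (\<integral>\<^sup>+r. indicator {0<..<1} r * emeasure lborel {s. r < a s} \<partial>lborel) + (\<integral>\<^sup>+r. indicator {0<..<1} r * emeasure lborel {s. r < b s} \<partial>lborel)"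
    by (subst (1 2) nn_integral_layer_cake_bounded(2)[where b = 1]) (use a b in auto)
  also have "\<dots> = (\<integral>\<^sup>+r. indicator {0<..<1} r * (emeasure lborel {s. r < a s} + emeasure lborel {s. r < b s}) \<partial>lborel)"
    by (subst nn_integral_add[symmetric]) (auto simp: distrib_left)
  also have "\<dots> \<le> (\<integral>\<^sup>+r. 2 * (indicator {0<..<1} r * emeasure lborel {z. r < ?w z}) \<partial>lborel)"
    using key by (intro nn_integral_mono) (auto simp: indicator_def)
  also have "\<dots> = 2 * (\<integral>\<^sup>+r. (indicator {0<..<1} r * emeasure lborel {z. r < ?w z}) \<partial>lborel)"
    by (rule nn_integral_cmult) simp
  also have "\<dots> \<le> 2 * (\<integral>\<^sup>+x. ennreal (?w x) \<partial>lborel)"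
    using c by (intro mult_left_mono nn_integral_layer_cake_bounded(1)) auto
  also have "(\<integral>\<^sup>+x. ennreal (?w x) \<partial>lborel) = ennreal c * (\<integral>\<^sup>+x. std_normal_density x \<partial>lborel)"
    using c by (subst nn_integral_cmult[symmetric]) (auto simp: ennreal_mult')
  also have "(\<integral>\<^sup>+x. std_normal_density x \<partial>lborel) = 1"
    using prob_space.emeasure_space_1[OF prob_space_normal_density[of 1 0]]
    by (simp add: emeasure_density)
  finally show ?thesis using c by (simp add: ennreal_mult')
qed

lemma obtain_normalisation:
  fixes f :: "real \<Rightarrow> real"
  assumes f: "\<And>s. 0 \<le> f s" and bdd: "\<And>s. f s \<le> B" and pos: "0 < f s0"
  obtains \<alpha> where "0 < \<alpha>" "\<And>s. f s / \<alpha> \<le> 1" "\<And>r. r < 1 \<Longrightarrow> \<exists>s. r < f s / \<alpha>"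
proof
  let ?\<alpha> = "SUP s. f s"
  have bdd': "bdd_above (range f)" using bdd by (auto intro!: bdd_aboveI[of _ B])
  have le: "f s \<le> ?\<alpha>" for s by (rule cSUP_upper[OF UNIV_I bdd'])
  show \<alpha>: "0 < ?\<alpha>" using pos le[of s0] by linarith
  show "f s / ?\<alpha> \<le> 1" for s using le \<alpha> by simp
  show "\<exists>s. r < f s / ?\<alpha>" if "r < 1" for r
  proof -
    have "r * ?\<alpha> < ?\<alpha>" using \<alpha> that by simp
    then obtain s where "r * ?\<alpha> < f s" using bdd' by (auto simp: less_cSUP_iff)
    then show ?thesis using \<alpha> by (auto simp: less_divide_eq)
  qed
qed

text \<open>Dividing by the suprema \<open>\<alpha>\<close> and \<open>\<beta>\<close> scales the
  dominating density by \<open>c = 1 / sqrt (\<alpha> * \<beta>)\<close>. The additive bound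
  \<open>A + B \<le> 2 * c\<close> then gives \<open>A * B \<le> c\<^sup>2\<close> by the
  arithmetic-geometric mean inequality, and undoing the scaling gives 1.\<close>

lemma gauss_PL_real:
  fixes a b :: "real \<Rightarrow> real"
  assumes [measurable]: "a \<in> borel_measurable borel" "b \<in> borel_measurable borel"
    and a: "\<And>s. 0 \<le> a s" and b: "\<And>s. 0 \<le> b s" and pos: "0 < a s0" "0 < b t0"
    and ab: "\<And>s t. a s * b t \<le> (std_normal_density ((s + t) / 2))\<^sup>2"
  shows "(\<integral>\<^sup>+s. ennreal (a s) \<partial>lborel) * (\<integral>\<^sup>+s. ennreal (b s) \<partial>lborel) \<le> 1"
proof -
  have le1: "(std_normal_density x)\<^sup>2 \<le> 1" for x
  proof -
    have "sqrt (2 * pi) \<ge> 1" using pi_ge_two by simp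
    then have "std_normal_density x \<le> 1"
      unfolding std_normal_density_def by (simp add: divide_le_eq mult_le_one order_trans[of _ 1])
    then show ?thesis by (simp add: power_le_one)
  qed
  have ab1: "a s * b t \<le> 1" for s t using ab[of s t] le1[of "(s + t) / 2"] by linarith
  \<comment> \<open>A point where one function is positive bounds the other one, since products of
    values never exceed 1.\<close>
  obtain \<alpha> where \<alpha>: "0 < \<alpha>" "\<And>s. a s / \<alpha> \<le> 1" "\<And>r. r < 1 \<Longrightarrow> \<exists>s. r < a s / \<alpha>"
    by (rule obtain_normalisation[of a "1 / b t0" s0]) (use a pos ab1[of _ t0] in \<open>auto simp: pos_le_divide_eq\<close>)
  obtain \<beta> where \<beta>: "0 < \<beta>" "\<And>s. b s / \<beta> \<le> 1" "\<And>r. r < 1 \<Longrightarrow> \<exists>s. r < b s / \<beta>"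
    by (rule obtain_normalisation[of b "1 / a s0" t0])
      (use b pos ab1[of s0] in \<open>auto simp: pos_le_divide_eq mult.commute\<close>)
  define c where "c = 1 / sqrt (\<alpha> * \<beta>)"
  have c: "0 < c" "c\<^sup>2 * (\<alpha> * \<beta>) = 1" using \<alpha>(1) \<beta>(1) by (auto simp: c_def power_divide)
  define A where "A = (\<integral>\<^sup>+s. ennreal (a s / \<alpha>) \<partial>lborel)"
  define B where "B = (\<integral>\<^sup>+s. ennreal (b s / \<beta>) \<partial>lborel)"
  have "A + B \<le> ennreal (2 * c)" unfolding A_def B_def
  proof (rule gauss_PL_normalised)
    show "a s / \<alpha> * (b t / \<beta>) \<le> (c * std_normal_density ((s + t) / 2))\<^sup>2" for s t
    proof -
      have "a s / \<alpha> * (b t / \<beta>) = c\<^sup>2 * (a s * b t)" using \<alpha> \<beta> by (simp add: c_def power_divide)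
      also have "\<dots> \<le> c\<^sup>2 * (std_normal_density ((s + t) / 2))\<^sup>2" by (intro mult_left_mono ab) auto
      finally show ?thesis by (simp add: power_mult_distrib)
    qed
  qed (use a b \<alpha> \<beta> c in auto)
  moreover have "A < \<infinity>" "B < \<infinity>" using calculation by (auto simp: top.not_eq_extremum[symmetric] top_unique)
  ultimately obtain A' B' where AB: "A = ennreal A'" "0 \<le> A'" "B = ennreal B'" "0 \<le> B'" "A' + B' \<le> 2 * c"
    using c by (cases A; cases B) (auto simp flip: ennreal_plus)
  have "(A' + B')\<^sup>2 \<le> (2 * c)\<^sup>2" using AB by (intro power_mono) auto
  moreover have "4 * (A' * B') \<le> (A' + B')\<^sup>2"
    using zero_le_power2[of "A' - B'"] by (simp add: power2_eq_square algebra_simps)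
  ultimately have "A' * B' \<le> c\<^sup>2" by (simp add: power2_eq_square)
  then have "\<alpha> * \<beta> * (A' * B') \<le> \<alpha> * \<beta> * c\<^sup>2" using \<alpha> \<beta> by (intro mult_left_mono) auto
  then have fin: "\<alpha> * \<beta> * (A' * B') \<le> 1" using c by (simp add: mult.commute)
  have "(\<integral>\<^sup>+s. ennreal (a s) \<partial>lborel) = ennreal \<alpha> * A" unfolding A_def
    using \<alpha>(1) by (subst nn_integral_cmult[symmetric]) (auto simp flip: ennreal_mult')
  moreover have "(\<integral>\<^sup>+s. ennreal (b s) \<partial>lborel) = ennreal \<beta> * B" unfolding B_def
    using \<beta>(1) by (subst nn_integral_cmult[symmetric]) (auto simp flip: ennreal_mult')
  ultimately have "(\<integral>\<^sup>+s. ennreal (a s) \<partial>lborel) * (\<integral>\<^sup>+s. ennreal (b s) \<partial>lborel) = ennreal (\<alpha> * \<beta> * (A' * B'))"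
    using \<alpha> \<beta> AB by (simp add: ennreal_mult algebra_simps)
  then show ?thesis using fin by simp
qed

lemma gauss_PL_1:
  fixes u v :: "real \<Rightarrow> ennreal"
  assumes [measurable]: "u \<in> borel_measurable borel" "v \<in> borel_measurable borel"
    and uv: "\<And>s t. u s * v t \<le> ennreal (exp ((s - t)\<^sup>2 / 4))"
  shows "(\<integral>\<^sup>+s. u s \<partial>gauss1) * (\<integral>\<^sup>+s. v s \<partial>gauss1) \<le> 1"
proof (cases "(\<forall>s. u s = 0) \<or> (\<forall>t. v t = 0)")
  case True
  then show ?thesis by auto
next
  case False
  then obtain s0 t0 where st0: "u s0 \<noteq> 0" "v t0 \<noteq> 0" by auto
  \<comment> \<open>A nonzero value of one function forces the other to be finite everywhere, which
    permits passing to real-valued functions.\<close>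
  have fin: "u s < \<infinity>" "v t < \<infinity>" for s t
    using uv[of s t0] uv[of s0 t] st0 by (auto simp: less_top[symmetric] ennreal_top_mult ennreal_mult_top top_unique)
  let ?a = "\<lambda>s. std_normal_density s * enn2real (u s)"
  let ?b = "\<lambda>s. std_normal_density s * enn2real (v s)"
  have "(\<integral>\<^sup>+s. ennreal (?a s) \<partial>lborel) * (\<integral>\<^sup>+s. ennreal (?b s) \<partial>lborel) \<le> 1"
  proof (rule gauss_PL_real)
    show "0 < ?a s0" "0 < ?b t0" using st0 fin
      by (auto intro!: mult_pos_pos normal_density_pos simp: enn2real_positive_iff zero_less_iff_neq_zero)
    show "?a s * ?b t \<le> (std_normal_density ((s + t) / 2))\<^sup>2" for s t
    proof -
      have "ennreal (enn2real (u s) * enn2real (v t)) \<le> ennreal (exp ((s - t)\<^sup>2 / 4))"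
        using uv[of s t] fin by (simp add: ennreal_mult)
      then have "enn2real (u s) * enn2real (v t) \<le> exp ((s - t)\<^sup>2 / 4)" by (simp add: ennreal_le_iff)
      then have "(std_normal_density s * std_normal_density t) * (enn2real (u s) * enn2real (v t)) \<le>
          (std_normal_density s * std_normal_density t) * exp ((s - t)\<^sup>2 / 4)"
        by (intro mult_left_mono) auto
      then show ?thesis unfolding gauss_mult_le by (simp add: mult_ac)
    qed
  qed auto
  also have "(\<integral>\<^sup>+s. ennreal (?a s) \<partial>lborel) = (\<integral>\<^sup>+s. u s \<partial>gauss1)"
    using fin by (subst nn_integral_density) (auto simp: ennreal_mult)
  also have "(\<integral>\<^sup>+s. ennreal (?b s) \<partial>lborel) = (\<integral>\<^sup>+s. v s \<partial>gauss1)"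
    using fin by (subst nn_integral_density) (auto simp: ennreal_mult)
  finally show ?thesis .
qed

section \<open>Tensorization of property (tau) over the coordinates\<close>

interpretation gauss_prod: product_sigma_finite "\<lambda>_::nat. gauss1"
  by (intro product_sigma_finite.intro prob_space_imp_sigma_finite prob_space_normal_density) simp

text \<open>Induction on the dimension, integrating out the last coordinate. For fixed
  \<open>x\<close> and \<open>y\<close> the one-dimensional inequality bounds
  \<open>U x * V y\<close> by the exponential of the remaining coordinates, which is the induction
  hypothesis for \<open>U\<close> and \<open>V\<close>.\<close>

lemma gauss_PL:
  fixes u v :: "(nat \<Rightarrow> real) \<Rightarrow> ennreal"
  assumes "u \<in> borel_measurable (std_gaussian n)" "v \<in> borel_measurable (std_gaussian n)"
    and "\<And>x y. x \<in> space (std_gaussian n) \<Longrightarrow> y \<in> space (std_gaussian n) \<Longrightarrow>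
       u x * v y \<le> ennreal (exp ((\<Sum>i<n. (x i - y i)\<^sup>2) / 4))"
  shows "(\<integral>\<^sup>+x. u x \<partial>std_gaussian n) * (\<integral>\<^sup>+x. v x \<partial>std_gaussian n) \<le> 1"
  using assms
proof (induction n arbitrary: u v)
  case 0
  \<comment> \<open>In dimension 0 the sample space is this single point and the sum in the exponent
    is empty.\<close>
  have "(\<lambda>_. undefined) \<in> space (std_gaussian 0)" by (simp add: std_gaussian_def space_PiM)
  from 0(3)[OF this this] show ?case
    by (simp add: std_gaussian_def nn_integral_empty PiM_empty nn_integral_count_space_finite lessThan_0)
next
  case (Suc n)
  note [measurable] = Suc.prems(1,2)[unfolded std_gaussian_def lessThan_Suc]
  define U where "U = (\<lambda>x. \<integral>\<^sup>+s. u (x(n := s)) \<partial>gauss1)"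
  define V where "V = (\<lambda>x. \<integral>\<^sup>+s. v (x(n := s)) \<partial>gauss1)"
  have [measurable]: "(\<lambda>(x, s). x(n := s)) \<in> measurable (std_gaussian n \<Otimes>\<^sub>M gauss1) (PiM (insert n {..<n}) (\<lambda>_. gauss1))"
    unfolding std_gaussian_def by (rule measurable_add_dim)
  have ext: "x(n := s) \<in> space (std_gaussian (Suc n))" if "x \<in> space (std_gaussian n)" for x s
    using that by (auto simp: std_gaussian_def space_PiM PiE_iff extensional_def)
  have sect: "(\<lambda>s. f (x(n := s))) \<in> borel_measurable borel"
    if "f \<in> borel_measurable (std_gaussian (Suc n))" "x \<in> space (std_gaussian n)" for f :: "_ \<Rightarrow> ennreal" and x
  proof -
    have "(\<lambda>s. x(n := s)) \<in> measurable gauss1 (PiM (insert n {..<n}) (\<lambda>_. gauss1))"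
      by (rule measurable_component_update) (use that in \<open>auto simp: std_gaussian_def\<close>)
    then have "(\<lambda>s. x(n := s)) \<in> measurable gauss1 (std_gaussian (Suc n))"
      by (simp add: std_gaussian_def lessThan_Suc)
    from measurable_compose[OF this that(1)] show ?thesis by simp
  qed
  have sp: "sigma_finite_measure gauss1"
    by (intro prob_space_imp_sigma_finite prob_space_normal_density) simp
  have meas: "(\<lambda>x. \<integral>\<^sup>+s. f (x(n := s)) \<partial>gauss1) \<in> borel_measurable (std_gaussian n)"
    if [measurable]: "f \<in> borel_measurable (PiM (insert n {..<n}) (\<lambda>_. gauss1))" for f :: "_ \<Rightarrow> ennreal"
    by (rule sigma_finite_measure.borel_measurable_nn_integral[OF sp]) measurable
  have "(\<integral>\<^sup>+x. U x \<partial>std_gaussian n) * (\<integral>\<^sup>+x. V x \<partial>std_gaussian n) \<le> 1"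
  proof (rule Suc.IH)
    show "U \<in> borel_measurable (std_gaussian n)" "V \<in> borel_measurable (std_gaussian n)"
      unfolding U_def V_def by (intro meas; measurable)+
    fix x y assume xy: "x \<in> space (std_gaussian n)" "y \<in> space (std_gaussian n)"
    define e where "e = exp ((\<Sum>i<n. (x i - y i)\<^sup>2) / 4)"
    have e: "0 < e" by (simp add: e_def)
    \<comment> \<open>Dividing by \<open>e\<close> removes the contribution of the first
      \<open>n\<close> coordinates and leaves the one-dimensional hypothesis in \<open>s\<close> and
      \<open>t\<close>.\<close>
    have "(\<integral>\<^sup>+s. u (x(n := s)) / ennreal e \<partial>gauss1) * (\<integral>\<^sup>+s. v (y(n := s)) \<partial>gauss1) \<le> 1"
    proof (rule gauss_PL_1)
      show "(\<lambda>s. u (x(n := s)) / ennreal e) \<in> borel_measurable borel"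
        using sect[OF Suc.prems(1) xy(1)] by measurable
      show "(\<lambda>s. v (y(n := s))) \<in> borel_measurable borel" by (rule sect[OF Suc.prems(2) xy(2)])
      fix s t
      have "u (x(n := s)) * v (y(n := t)) \<le> ennreal (exp ((\<Sum>i<Suc n. ((x(n := s)) i - (y(n := t)) i)\<^sup>2) / 4))"
        by (rule Suc.prems(3)[OF ext[OF xy(1)] ext[OF xy(2)]])
      also have "(\<Sum>i<Suc n. ((x(n := s)) i - (y(n := t)) i)\<^sup>2) = (\<Sum>i<n. (x i - y i)\<^sup>2) + (s - t)\<^sup>2" by simp
      also have "ennreal (exp (\<dots> / 4)) = ennreal (exp ((s - t)\<^sup>2 / 4)) * ennreal e"
        by (simp add: e_def add_divide_distrib exp_add ennreal_mult mult.commute)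
      finally have "u (x(n := s)) * v (y(n := t)) / ennreal e \<le> ennreal (exp ((s - t)\<^sup>2 / 4)) * ennreal e / ennreal e"
        by (rule divide_right_mono_ennreal)
      then show "u (x(n := s)) / ennreal e * v (y(n := t)) \<le> ennreal (exp ((s - t)\<^sup>2 / 4))"
        using e by (simp add: ennreal_mult_divide_eq ennreal_divide_times ennreal_times_divide)
    qed
    also have "(\<integral>\<^sup>+s. u (x(n := s)) / ennreal e \<partial>gauss1) = U x / ennreal e"
      unfolding U_def
      by (rule nn_integral_divide, subst measurable_cong_sets[of gauss1 borel borel borel], simp, simp, rule sect[OF Suc.prems(1) xy(1)])
    finally have "U x / ennreal e * V y \<le> 1" by (simp only: V_def)
    then have "U x / ennreal e * V y * ennreal e \<le> 1 * ennreal e" by (rule mult_right_mono) simp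
    also have "U x / ennreal e * V y * ennreal e = U x * V y * (ennreal e / ennreal e)"
      by (simp only: ennreal_divide_times[of "U x"] ennreal_times_divide[of "U x"] ennreal_divide_times[of "U x * V y"])
    finally show "U x * V y \<le> ennreal (exp ((\<Sum>i<n. (x i - y i)\<^sup>2) / 4))"
      unfolding e_def[symmetric] using e by simp
  qed
  moreover have "(\<integral>\<^sup>+x. U x \<partial>std_gaussian n) = (\<integral>\<^sup>+x. u x \<partial>std_gaussian (Suc n))"
    using gauss_prod.product_nn_integral_insert[of "{..<n}" n u] Suc.prems(1)
    unfolding U_def std_gaussian_def lessThan_Suc by (metis finite_lessThan lessThan_iff less_irrefl)
  moreover have "(\<integral>\<^sup>+x. V x \<partial>std_gaussian n) = (\<integral>\<^sup>+x. v x \<partial>std_gaussian (Suc n))"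
    using gauss_prod.product_nn_integral_insert[of "{..<n}" n v] Suc.prems(2)
    unfolding V_def std_gaussian_def lessThan_Suc by (metis finite_lessThan lessThan_iff less_irrefl)
  ultimately show ?case by (simp only:)
qed

section \<open>Concentration inequalities\<close>

lemma prob_space_std_gaussian: "prob_space (std_gaussian n)"
  unfolding std_gaussian_def by (intro prob_space_PiM prob_space_normal_density) simp

interpretation gauss: prob_space "std_gaussian n" for n
  by (rule prob_space_std_gaussian)

lemma space_std_gaussian: "space (std_gaussian n) = {..<n} \<rightarrow>\<^sub>E UNIV"
  by (simp add: std_gaussian_def space_PiM)

lemma sets_std_gaussian: "sets (std_gaussian n) = sets (PiM {..<n} (\<lambda>_. borel))"
  unfolding std_gaussian_def by (intro sets_PiM_cong) auto

lemma measurable_std_gaussian_component [measurable]: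
  "i < n \<Longrightarrow> (\<lambda>x. x i) \<in> borel_measurable (std_gaussian n)"
  unfolding measurable_cong_sets[OF sets_std_gaussian refl] by measurable

lemma gauss_component_square:
  assumes "i < n"
  shows "integrable (std_gaussian n) (\<lambda>x. (x i)\<^sup>2)" "(\<integral>x. (x i)\<^sup>2 \<partial>std_gaussian n) = 1"
proof -
  interpret product_prob_space "\<lambda>_::nat. gauss1" "{..<n}"
    by (intro product_prob_space.intro product_sigma_finite.intro product_prob_space_axioms.intro
        prob_space_imp_sigma_finite prob_space_normal_density) simp_all
  have d: "distr (std_gaussian n) gauss1 (\<lambda>x. x i) = gauss1"
    unfolding std_gaussian_def using assms by (intro PiM_component) simp
  have m: "(\<lambda>x. x i) \<in> measurable (std_gaussian n) gauss1" using assms by simp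
  have b: "has_bochner_integral gauss1 (\<lambda>x. x\<^sup>2) 1"
    using std_normal_moment_even[of 1] by (intro has_bochner_integral_density) (auto simp: power2_eq_square)
  have "integrable (distr (std_gaussian n) gauss1 (\<lambda>x. x i)) (\<lambda>x. x\<^sup>2)"
    unfolding d using b by (simp add: has_bochner_integral_iff)
  then show "integrable (std_gaussian n) (\<lambda>x. (x i)\<^sup>2)"
    by (subst (asm) integrable_distr_eq[OF m]) simp_all
  have "(\<integral>x. (x i)\<^sup>2 \<partial>std_gaussian n) = (\<integral>x. x\<^sup>2 \<partial>distr (std_gaussian n) gauss1 (\<lambda>x. x i))"
    by (rule integral_distr[symmetric, OF m]) simp
  also have "\<dots> = 1" unfolding d using b by (simp add: has_bochner_integral_iff)
  finally show "(\<integral>x. (x i)\<^sup>2 \<partial>std_gaussian n) = 1" .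
qed

lemma vnorm_power2: "(vnorm n x)\<^sup>2 = (\<Sum>i<n. (x i)\<^sup>2)"
  unfolding L2_set_def by (simp add: sum_nonneg)

lemma gauss_vnorm_power2:
  "integrable (std_gaussian n) (\<lambda>x. (vnorm n x)\<^sup>2)" "(\<integral>x. (vnorm n x)\<^sup>2 \<partial>std_gaussian n) = real n"
  unfolding vnorm_power2 by (auto simp: gauss_component_square)

text \<open>Jensen's inequality through \<open>1 + z \<le> exp z\<close>; an infinite integral
  satisfies the bound trivially.\<close>

lemma gauss_one_le_exp:
  assumes F: "integrable (std_gaussian n) F"
  shows "1 \<le> (\<integral>\<^sup>+x. ennreal (exp ((\<integral>y. F y \<partial>std_gaussian n) - F x)) \<partial>std_gaussian n)"
proof -
  let ?m = "\<integral>y. F y \<partial>std_gaussian n"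
  have [measurable]: "F \<in> borel_measurable (std_gaussian n)" using F by simp
  show ?thesis
  proof (cases "(\<integral>\<^sup>+x. ennreal (exp (?m - F x)) \<partial>std_gaussian n) < \<infinity>")
    case True
    then have int: "integrable (std_gaussian n) (\<lambda>x. exp (?m - F x))"
      by (intro integrableI_nonneg) auto
    have "1 = (\<integral>x. 1 + (?m - F x) \<partial>std_gaussian n)" using F by (simp add: gauss.prob_space)
    also have "\<dots> \<le> (\<integral>x. exp (?m - F x) \<partial>std_gaussian n)"
      using F int by (intro integral_mono) (auto intro: exp_ge_add_one_self)
    finally show ?thesis using int by (subst nn_integral_eq_integral) auto
  next
    case False
    then show ?thesis by (simp add: less_top[symmetric])
  qed
qed

lemma gauss_exp_bound:
  assumes F: "integrable (std_gaussian n) F" and R: "R \<in> borel_measurable (std_gaussian n)"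
    and FR: "\<And>x y. x \<in> space (std_gaussian n) \<Longrightarrow> y \<in> space (std_gaussian n) \<Longrightarrow>
      F x - F y \<le> R x + (vnorm n (vsub n x y))\<^sup>2 / 4"
  shows "(\<integral>\<^sup>+x. ennreal (exp (F x - (\<integral>y. F y \<partial>std_gaussian n) - R x)) \<partial>std_gaussian n) \<le> 1"
proof -
  let ?m = "\<integral>y. F y \<partial>std_gaussian n"
  note [measurable] = R
  have [measurable]: "F \<in> borel_measurable (std_gaussian n)" using F by simp
  have "(\<integral>\<^sup>+x. ennreal (exp (F x - ?m - R x)) \<partial>std_gaussian n) * 1 \<le>
      (\<integral>\<^sup>+x. ennreal (exp (F x - ?m - R x)) \<partial>std_gaussian n) * (\<integral>\<^sup>+x. ennreal (exp (?m - F x)) \<partial>std_gaussian n)"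
    by (intro mult_left_mono gauss_one_le_exp F) simp
  also have "\<dots> \<le> 1"
  proof (rule gauss_PL)
    fix x y assume "x \<in> space (std_gaussian n)" "y \<in> space (std_gaussian n)"
    from FR[OF this] have "F x - ?m - R x + (?m - F y) \<le> (vnorm n (vsub n x y))\<^sup>2 / 4" by simp
    also have "(vnorm n (vsub n x y))\<^sup>2 = (\<Sum>i<n. (x i - y i)\<^sup>2)" by (simp add: vnorm_power2 vsub_def)
    finally show "ennreal (exp (F x - ?m - R x)) * ennreal (exp (?m - F y)) \<le> ennreal (exp ((\<Sum>i<n. (x i - y i)\<^sup>2) / 4))"
      by (simp add: ennreal_mult[symmetric] exp_add[symmetric])
  qed measurable
  finally show ?thesis by simp
qed

text \<open>Exponential Markov inequality. \<open>R\<close> may vary with the sample point, so the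
  threshold itself is random; this is what the process \<open>lrt\<close> calls for.\<close>

lemma gauss_tail:
  assumes F: "integrable (std_gaussian n) F" and R: "R \<in> borel_measurable (std_gaussian n)"
    and FR: "\<And>x y. x \<in> space (std_gaussian n) \<Longrightarrow> y \<in> space (std_gaussian n) \<Longrightarrow>
      F x - F y \<le> R x + (vnorm n (vsub n x y))\<^sup>2 / 4"
  shows "measure (std_gaussian n) {x \<in> space (std_gaussian n). R x + t < F x - (\<integral>y. F y \<partial>std_gaussian n)} \<le> exp (- t)"
    (is "measure _ ?S \<le> _")
proof -
  let ?m = "\<integral>y. F y \<partial>std_gaussian n"
  note [measurable] = R
  have [measurable]: "F \<in> borel_measurable (std_gaussian n)" using F by simp
  have "emeasure (std_gaussian n) ?S = (\<integral>\<^sup>+x. indicator ?S x \<partial>std_gaussian n)" by simp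
  also have "\<dots> \<le> (\<integral>\<^sup>+x. ennreal (exp (- t)) * ennreal (exp (F x - ?m - R x)) \<partial>std_gaussian n)"
    by (intro nn_integral_mono) (auto simp: indicator_def ennreal_mult[symmetric] exp_add[symmetric] simp flip: ennreal_1)
  also have "\<dots> = ennreal (exp (- t)) * (\<integral>\<^sup>+x. ennreal (exp (F x - ?m - R x)) \<partial>std_gaussian n)"
    by (rule nn_integral_cmult) measurable
  also have "\<dots> \<le> ennreal (exp (- t)) * 1"
    by (intro mult_left_mono gauss_exp_bound assms) auto
  finally show ?thesis unfolding gauss.emeasure_eq_measure by simp
qed

lemma vnorm_vsub_commute: "vnorm n (vsub n x y) = vnorm n (vsub n y x)"
  unfolding L2_set_def vsub_def by (simp add: power2_commute)

text \<open>Composed with restriction to \<open>{..<n}\<close>, \<open>f\<close> becomes continuous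
  on all sequences in the product topology, hence Borel; it is then pulled back to the sample
  space.\<close>

lemma borel_measurable_lipschitz:
  assumes f: "\<And>x y. x \<in> {..<n} \<rightarrow>\<^sub>E UNIV \<Longrightarrow> y \<in> {..<n} \<rightarrow>\<^sub>E UNIV \<Longrightarrow> \<bar>f x - f y\<bar> \<le> L * vnorm n (vsub n x y)"
  shows "f \<in> borel_measurable (std_gaussian n)"
proof -
  let ?g = "\<lambda>x. f (restrict x {..<n})"
  have "continuous_on UNIV ?g"
  proof (clarsimp simp: continuous_on_def)
    fix a :: "nat \<Rightarrow> real"
    have comp: "((\<lambda>x. x i) \<longlongrightarrow> a i) (at a)" for i
    proof -
      have "continuous_on UNIV (\<lambda>x::nat \<Rightarrow> real. x i)" by (rule continuous_on_product_coordinates)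
      then show ?thesis by (simp add: continuous_on_def)
    qed
    have "((\<lambda>x. L * sqrt (\<Sum>i<n. (x i - a i)\<^sup>2)) \<longlongrightarrow> L * sqrt (\<Sum>i<n. (a i - a i)\<^sup>2)) (at a)"
      by (intro tendsto_intros comp)
    then have lim: "((\<lambda>x. L * sqrt (\<Sum>i<n. (x i - a i)\<^sup>2)) \<longlongrightarrow> 0) (at a)" by simp
    have "\<bar>?g x - ?g a\<bar> \<le> L * sqrt (\<Sum>i<n. (x i - a i)\<^sup>2)" for x
      using f[of "restrict x {..<n}" "restrict a {..<n}"] by (simp add: L2_set_def vsub_def)
    then have "((\<lambda>x. ?g x - ?g a) \<longlongrightarrow> 0) (at a)"
      by (intro Lim_null_comparison[OF _ lim]) auto
    then show "(?g \<longlongrightarrow> ?g a) (at a)" by (rule LIM_zero_cancel)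
  qed
  then have "?g \<in> borel_measurable borel" by (rule borel_measurable_continuous_onI)
  \<comment> \<open>A sample is \<open>undefined\<close> from index \<open>n\<close> on; padding by
    0 maps it measurably into the space of sequences, and restriction undoes the padding.\<close>
  moreover have "(\<lambda>x i. if i < n then x i else 0) \<in> measurable (std_gaussian n) (borel :: (nat \<Rightarrow> real) measure)"
    unfolding sets_PiM_equal_borel[symmetric] measurable_cong_sets[OF refl sets_PiM_equal_borel[symmetric]]
  proof (rule measurable_PiM_single')
    show "(\<lambda>x. if i < n then x i else 0) \<in> borel_measurable (std_gaussian n)" for i
      by (cases "i < n") simp_all
  qed simp
  ultimately have "(\<lambda>x. ?g (\<lambda>i. if i < n then x i else 0)) \<in> borel_measurable (std_gaussian n)"
    by (rule measurable_compose[rotated])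
  moreover have "?g (\<lambda>i. if i < n then x i else 0) = f x" if "x \<in> space (std_gaussian n)" for x
  proof -
    have "restrict (\<lambda>i. if i < n then x i else 0) {..<n} = x"
      using that by (auto simp: space_std_gaussian PiE_iff extensional_def restrict_def)
    then show ?thesis by simp
  qed
  ultimately show ?thesis by (subst (asm) measurable_cong) auto
qed

section \<open>Metric projections\<close>

lemma vinner_commute: "vinner n x y = vinner n y x"
  by (simp add: vinner_def mult.commute)

lemma vinner_vsub_left: "vinner n (vsub n x y) z = vinner n x z - vinner n y z"
  by (simp add: vinner_def vsub_def sum_subtractf algebra_simps)

lemma vinner_vsub_right: "vinner n z (vsub n x y) = vinner n z x - vinner n z y"
  by (simp add: vinner_def vsub_def sum_subtractf algebra_simps)

lemma vinner_vscale_left: "vinner n (vscale n a x) z = a * vinner n x z"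
  by (simp add: vinner_def vscale_def sum_distrib_left algebra_simps)

lemma vinner_vscale_right: "vinner n z (vscale n a x) = a * vinner n z x"
  by (simp add: vinner_def vscale_def sum_distrib_left algebra_simps)

lemmas vinner_bilinear = vinner_vsub_left vinner_vsub_right vinner_vscale_left vinner_vscale_right

lemma vinner_self: "vinner n x x = (vnorm n x)\<^sup>2"
  unfolding vnorm_power2 by (simp add: vinner_def power2_eq_square)

lemma vinner_le: "vinner n x y \<le> vnorm n x * vnorm n y"
proof -
  have "vinner n x y \<le> (\<Sum>i<n. \<bar>x i\<bar> * \<bar>y i\<bar>)"
    unfolding vinner_def by (intro sum_mono) (metis abs_ge_self abs_mult)
  also have "\<dots> \<le> vnorm n x * vnorm n y" by (rule L2_set_mult_ineq)
  finally show ?thesis .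
qed

lemma vnorm_vsub_vscale_power2:
  "(vnorm n (vsub n h (vscale n a x)))\<^sup>2 = (vnorm n h)\<^sup>2 - 2 * a * vinner n h x + a\<^sup>2 * (vnorm n x)\<^sup>2"
  unfolding vinner_self[symmetric] by (simp add: vinner_bilinear vinner_commute[of n x h] power2_eq_square algebra_simps)

lemma abs_component_le_vnorm: "i < n \<Longrightarrow> \<bar>x i\<bar> \<le> vnorm n x"
  using member_le_L2_set[of "{..<n}" i "\<lambda>i. \<bar>x i\<bar>"] by (simp add: L2_set_def)

lemma vnorm_triangle: "vnorm n (vsub n x z) \<le> vnorm n (vsub n x y) + vnorm n (vsub n y z)"
proof -
  have "vnorm n (vsub n x z) = L2_set (\<lambda>i. vsub n x y i + vsub n y z i) {..<n}"
    by (rule L2_set_cong) (auto simp: vsub_def)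
  then show ?thesis using L2_set_triangle_ineq by metis
qed

text \<open>Points of \<open>C\<close> no farther from \<open>x\<close> than \<open>c0\<close> lie
  in a compact box around \<open>x\<close>, where the continuous distance attains its
  minimum.\<close>

lemma nearest_point_exists:
  assumes C: "closedin (euclid_top n) C" and c0: "c0 \<in> C"
  shows "\<exists>p\<in>C. \<forall>c\<in>C. vnorm n (vsub n x p) \<le> vnorm n (vsub n x c)"
proof -
  define f where "f = (\<lambda>c. vnorm n (vsub n x c))"
  define B where "B = PiE {..<n} (\<lambda>i. {x i - f c0..x i + f c0})"
  have sub: "C \<subseteq> {..<n} \<rightarrow>\<^sub>E UNIV" using closedin_subset[OF C] by simp
  have inB: "c \<in> B" if "c \<in> C" "f c \<le> f c0" for c
  proof -
    have "\<bar>x i - c i\<bar> \<le> f c0" if "i < n" for i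
      using abs_component_le_vnorm[OF that, of "vsub n x c"] \<open>f c \<le> f c0\<close> that by (simp add: f_def vsub_def)
    then show ?thesis using sub that(1) by (force simp: B_def PiE_iff abs_le_iff)
  qed
  have "compactin (euclid_top n) B" unfolding B_def by (simp add: compactin_PiE)
  then have "compactin (euclid_top n) (C \<inter> B)" using C by (simp add: closed_Int_compactin)
  moreover have "continuous_map (euclid_top n) euclideanreal f"
    unfolding f_def L2_set_def vsub_def
    by (auto intro!: continuous_intros continuous_map_product_projection simp: restrict_def cong: sum.cong)
  ultimately have "compact (f ` (C \<inter> B))" using image_compactin by fastforce
  moreover have "c0 \<in> C \<inter> B" using c0 inB by simp
  ultimately obtain p where p: "p \<in> C \<inter> B" "\<forall>c\<in>C \<inter> B. f p \<le> f c"
    using compact_attains_inf[of "f ` (C \<inter> B)"] by blast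
  have "f p \<le> f c" if "c \<in> C" for c
  proof (cases "f c \<le> f c0")
    case True
    then show ?thesis using p inB that by auto
  next
    case False
    moreover have "f p \<le> f c0" using p(2) \<open>c0 \<in> C \<inter> B\<close> by (rule bspec)
    ultimately show ?thesis by simp
  qed
  then show ?thesis using p(1) by (auto simp: f_def)
qed

text \<open>Existence of a minimiser ensures that the choice behind \<open>arg_min_on\<close>
  returns one.\<close>

lemma metric_proj:
  assumes "closedin (euclid_top n) C" and "c0 \<in> C"
  shows metric_proj_in: "metric_proj n C x \<in> C"
    and metric_proj_le: "\<And>c. c \<in> C \<Longrightarrow> vnorm n (vsub n x (metric_proj n C x)) \<le> vnorm n (vsub n x c)"
proof -
  let ?P = "is_arg_min (\<lambda>y. vnorm n (vsub n x y)) (\<lambda>y. y \<in> C)"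
  have "\<exists>p. ?P p" using nearest_point_exists[OF assms, of x] by (auto simp: is_arg_min_linorder)
  then have "?P (metric_proj n C x)"
    unfolding metric_proj_def arg_min_on_def arg_min_def by (rule someI_ex)
  then show "metric_proj n C x \<in> C"
    and "\<And>c. c \<in> C \<Longrightarrow> vnorm n (vsub n x (metric_proj n C x)) \<le> vnorm n (vsub n x c)"
    by (auto simp: is_arg_min_linorder)
qed

text \<open>The distance to a set is 1-Lipschitz. Measurability of \<open>lrt\<close> and of the
  norm of the projection onto the tangent cone is derived from this.\<close>

lemma dist_metric_proj_lipschitz:
  assumes "closedin (euclid_top n) C" and "c0 \<in> C"
  shows "\<bar>vnorm n (vsub n x (metric_proj n C x)) - vnorm n (vsub n y (metric_proj n C y))\<bar> \<le> vnorm n (vsub n x y)"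
proof -
  have "vnorm n (vsub n x (metric_proj n C x)) - vnorm n (vsub n y (metric_proj n C y)) \<le> vnorm n (vsub n x y)" for x y
    using metric_proj_le[OF assms metric_proj_in[OF assms], of x y]
      vnorm_triangle[of n x "metric_proj n C y" y] by simp
  from this[of x y] this[of y x] show ?thesis by (simp add: vnorm_vsub_commute[of n y x])
qed

lemma measurable_vnorm [measurable]: "vnorm n \<in> borel_measurable (std_gaussian n)"
  unfolding L2_set_def by measurable

text \<open>First-order optimality: dividing by \<open>s\<close> and letting \<open>s\<close> tend
  to 0. The explicit \<open>s\<close> in the proof satisfies \<open>s * B < A\<close> when
  \<open>A > 0\<close>, against \<open>2 * A \<le> s * B\<close>.\<close>

lemma quadratic_nonneg_imp_linear_le:
  fixes A B :: real
  assumes "\<And>s. 0 < s \<Longrightarrow> s \<le> 1 \<Longrightarrow> 2 * s * A \<le> s\<^sup>2 * B" and B: "0 \<le> B"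
  shows "A \<le> 0"
proof (rule ccontr)
  assume A: "\<not> A \<le> 0"
  define s where "s = min 1 (A / (B + 1))"
  have "s \<le> A / (B + 1)" by (simp add: s_def)
  then have s3: "s * (B + 1) \<le> A" using B by (simp add: pos_le_divide_eq)
  have s: "0 < s" "s \<le> 1" using A B by (auto simp: s_def)
  have "2 * A \<le> s * B" using assms(1)[OF s(1,2)] s(1) by (simp add: power2_eq_square)
  then show False using s s3 A by (simp add: algebra_simps)
qed

section \<open>Projections onto closed cones\<close>

locale closed_cone =
  fixes n :: nat and T :: "(nat \<Rightarrow> real) set"
  assumes closed: "closedin (euclid_top n) T" and nonempty: "T \<noteq> {}"
    and scale: "\<And>a x. 0 \<le> a \<Longrightarrow> x \<in> T \<Longrightarrow> vscale n a x \<in> T"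
begin

abbreviation "p h \<equiv> metric_proj n T h"

lemma proj_le:
  assumes "x \<in> T" "0 \<le> a"
  shows "(vnorm n (vsub n h (p h)))\<^sup>2 \<le> (vnorm n h)\<^sup>2 - 2 * a * vinner n h x + a\<^sup>2 * (vnorm n x)\<^sup>2"
proof -
  obtain c0 where c0: "c0 \<in> T" using nonempty by auto
  show ?thesis unfolding vnorm_vsub_vscale_power2[symmetric]
    by (intro power_mono metric_proj_le[OF closed c0] scale assms) simp
qed

lemma proj_in: "p h \<in> T"
  using nonempty metric_proj_in[OF closed] by blast

text \<open>Pythagoras. The projection is optimal on its own ray, so \<open>a = 1\<close> maximises
  \<open>2 * a * A - a\<^sup>2 * B\<close> over \<open>a \<ge> 0\<close>; comparison with the vertex
  \<open>a = A / B\<close> forces \<open>A = B\<close>.\<close>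

lemma dist_proj: "(vnorm n (vsub n h (p h)))\<^sup>2 = (vnorm n h)\<^sup>2 - (vnorm n (p h))\<^sup>2"
proof -
  define A B where "A = vinner n h (p h)" and "B = (vnorm n (p h))\<^sup>2"
  have eq: "(vnorm n (vsub n h (p h)))\<^sup>2 = (vnorm n h)\<^sup>2 - 2 * A + B"
    unfolding vinner_self[symmetric] A_def B_def by (simp add: vinner_bilinear vinner_commute[of n "p h" h])
  have le: "2 * a * A - a\<^sup>2 * B \<le> 2 * A - B" if "0 \<le> a" for a
    using proj_le[OF proj_in that, of h h] unfolding eq A_def B_def by simp
  have "A = B"
  proof (cases "B = 0")
    case True
    then have "vnorm n (p h) = 0" by (simp add: B_def)
    then have "A \<le> 0" using vinner_le[of n h "p h"] by (simp add: A_def)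
    then show ?thesis using le[of 0] True by simp
  next
    case False
    then have B: "0 < B" by (simp add: B_def)
    have "0 \<le> A" using le[of 0] B by simp
    then have "2 * (A / B) * A - (A / B)\<^sup>2 * B \<le> 2 * A - B" using B by (intro le) simp
    then have "(A - B)\<^sup>2 \<le> 0" using B by (simp add: power2_eq_square field_simps)
    then show ?thesis by simp
  qed
  then show ?thesis using eq by (simp add: B_def)
qed

lemma vnorm_proj_le: "vnorm n (p h) \<le> vnorm n h"
proof -
  have "(vnorm n (p h))\<^sup>2 \<le> (vnorm n h)\<^sup>2" using dist_proj[of h] zero_le_power2[of "vnorm n (vsub n h (p h))"] by linarith
  then show ?thesis by (rule power2_le_imp_le) simp
qed

text \<open>Cauchy-Schwarz sharpened on the cone: the best point of the ray through
  \<open>x\<close>, at scale \<open>A / B\<^sup>2\<close>, reduces the squared distance by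
  \<open>(A / B)\<^sup>2\<close>, and no point of the cone reduces it by more than the squared norm
  of the projection.\<close>

lemma vinner_le_proj:
  assumes "x \<in> T"
  shows "vinner n h x \<le> vnorm n (p h) * vnorm n x"
proof (cases "vinner n h x \<le> 0 \<or> vnorm n x = 0")
  case True
  then show ?thesis using vinner_le[of n h x] by (auto intro: order_trans[OF _ mult_nonneg_nonneg])
next
  case False
  define A B where "A = vinner n h x" and "B = vnorm n x"
  have AB: "0 < A" "0 < B" using False by (auto simp: A_def B_def less_le)
  have "(vnorm n h)\<^sup>2 - (vnorm n (p h))\<^sup>2 \<le> (vnorm n h)\<^sup>2 - 2 * (A / B\<^sup>2) * A + (A / B\<^sup>2)\<^sup>2 * B\<^sup>2"
    using proj_le[OF assms, of "A / B\<^sup>2" h] AB unfolding dist_proj A_def B_def by simp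
  also have "\<dots> = (vnorm n h)\<^sup>2 - (A / B)\<^sup>2" using AB by (simp add: power2_eq_square field_simps)
  finally have "(A / B)\<^sup>2 \<le> (vnorm n (p h))\<^sup>2" by simp
  then have "A / B \<le> vnorm n (p h)" by (rule power2_le_imp_le) simp
  then show ?thesis using AB by (simp add: A_def[symmetric] B_def[symmetric] pos_divide_le_eq)
qed

text \<open>By Pythagoras the norm of the projection is a function of \<open>vnorm n h\<close> and
  of the distance to the cone, which is Lipschitz.\<close>

lemma measurable_vnorm_proj [measurable]: "(\<lambda>h. vnorm n (p h)) \<in> borel_measurable (std_gaussian n)"
proof -
  obtain c0 where c0: "c0 \<in> T" using nonempty by auto
  have [measurable]: "(\<lambda>h. vnorm n (vsub n h (p h))) \<in> borel_measurable (std_gaussian n)"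
    by (rule borel_measurable_lipschitz[where L = 1]) (simp add: dist_metric_proj_lipschitz[OF closed c0])
  have "vnorm n (p h) = sqrt ((vnorm n h)\<^sup>2 - (vnorm n (vsub n h (p h)))\<^sup>2)" for h
    by (simp add: dist_proj)
  then show ?thesis by simp
qed

lemma integrable_proj: "integrable (std_gaussian n) (\<lambda>h. (vnorm n (p h))\<^sup>2)"
  by (rule Bochner_Integration.integrable_bound[OF gauss_vnorm_power2(1)])
    (auto intro!: power_mono vnorm_proj_le)

lemma stat_dim_nonneg: "0 \<le> stat_dim n T"
  by (simp add: stat_dim_def)

lemma stat_dim_le: "stat_dim n T \<le> real n"
  unfolding stat_dim_def gauss_vnorm_power2(2)[of n, symmetric]
  by (intro integral_mono integrable_proj gauss_vnorm_power2(1) power_mono vnorm_proj_le) simp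

end

section \<open>The processes along a ray\<close>

text \<open>The last inequality says that \<open>f s / s\<^sup>2\<close> is nonincreasing, in a form
  that passes to means. The two bounds together give continuity and control \<open>f\<close> between
  consecutive grid points.\<close>

definition sandwich :: "(real \<Rightarrow> real) \<Rightarrow> bool" where
  "sandwich f \<longleftrightarrow> (\<forall>s>0. 0 \<le> f s) \<and> (\<forall>s t. 0 < s \<longrightarrow> s \<le> t \<longrightarrow> f s \<le> f t \<and> f t \<le> (t / s)\<^sup>2 * f s)"

text \<open>On either side of \<open>s\<close> the two bounds give a modulus of continuity that
  vanishes as \<open>t\<close> tends to \<open>s\<close>.\<close>

lemma sandwich_continuous:
  assumes f: "sandwich f"
  shows "continuous_on {0<..} f"
proof (intro continuous_at_imp_continuous_on ballI)
  fix s :: real assume "s \<in> {0<..}"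
  then have s: "0 < s" by simp
  have bound: "norm (f t - f s) \<le> \<bar>(t / s)\<^sup>2 - 1\<bar> * f s" if t: "0 < t" for t
  proof (cases "s \<le> t")
    case True
    then have "f s \<le> f t" "f t \<le> (t / s)\<^sup>2 * f s" using f s unfolding sandwich_def by blast+
    then have "norm (f t - f s) \<le> ((t / s)\<^sup>2 - 1) * f s" by (simp add: algebra_simps)
    also have "\<dots> \<le> \<bar>(t / s)\<^sup>2 - 1\<bar> * f s" using f s by (intro mult_right_mono) (auto simp: sandwich_def)
    finally show ?thesis .
  next
    case False
    then have *: "f t \<le> f s" "f s \<le> (s / t)\<^sup>2 * f t" using f t unfolding sandwich_def by auto
    from *(2) have "(t / s)\<^sup>2 * f s \<le> (t / s)\<^sup>2 * ((s / t)\<^sup>2 * f t)" by (intro mult_left_mono) auto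
    also have "\<dots> = f t" using s t by (simp add: power_divide)
    finally have "norm (f t - f s) \<le> (1 - (t / s)\<^sup>2) * f s" using * by (simp add: algebra_simps)
    also have "\<dots> \<le> \<bar>(t / s)\<^sup>2 - 1\<bar> * f s" using f s by (intro mult_right_mono) (auto simp: sandwich_def)
    finally show ?thesis .
  qed
  have "((\<lambda>t. \<bar>(t / s)\<^sup>2 - 1\<bar> * f s) \<longlongrightarrow> \<bar>(s / s)\<^sup>2 - 1\<bar> * f s) (at s)"
    using s by (intro tendsto_intros) auto
  then have lim: "((\<lambda>t. \<bar>(t / s)\<^sup>2 - 1\<bar> * f s) \<longlongrightarrow> 0) (at s)" using s by simp
  have "eventually (\<lambda>t. 0 < t) (at s)"
    using s by (intro order_tendstoD(1)[OF tendsto_ident_at])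
  then have "eventually (\<lambda>t. norm (f t - f s) \<le> \<bar>(t / s)\<^sup>2 - 1\<bar> * f s) (at s)"
    by (rule eventually_mono) (rule bound)
  then have "((\<lambda>t. f t - f s) \<longlongrightarrow> 0) (at s)" by (rule Lim_null_comparison[OF _ lim])
  then show "isCont f s" unfolding isCont_def by (rule LIM_zero_cancel)
qed

locale projection_process =
  fixes n :: nat and K :: "(nat \<Rightarrow> real) set" and \<mu>0 :: "nat \<Rightarrow> real"
  assumes closed: "closedin (euclid_top n) K" and conv: "vconvex n K" and mu0: "\<mu>0 \<in> K"
begin

text \<open>Displacement of the estimator from the truth. In terms of \<open>v\<close>,
  \<open>err\<close> is its squared norm, \<open>dof\<close> its inner product with the scaled
  noise, and \<open>lrt\<close> equals \<open>2 * dof - err\<close>.\<close>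

definition v :: "real \<Rightarrow> (nat \<Rightarrow> real) \<Rightarrow> (nat \<Rightarrow> real)" where
  "v \<sigma> h = vsub n (mu_hat n K \<mu>0 \<sigma> h) \<mu>0"

lemma mu_hat_in: "mu_hat n K \<mu>0 \<sigma> h \<in> K"
  unfolding mu_hat_def by (rule metric_proj_in[OF closed mu0])

text \<open>Obtuse-angle criterion for the projection, recentred at \<open>\<mu>0\<close>: moving
  from the projection towards \<open>k\<close> inside \<open>K\<close> cannot decrease the distance,
  and the first-order term gives the sign.\<close>

lemma variational_ineq:
  assumes k: "k \<in> K"
  defines "d \<equiv> vsub n k \<mu>0"
  shows "\<sigma> * vinner n h d - vinner n (v \<sigma> h) d \<le> \<sigma> * vinner n h (v \<sigma> h) - vinner n (v \<sigma> h) (v \<sigma> h)"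
proof -
  define p where "p = mu_hat n K \<mu>0 \<sigma> h"
  define x where "x = vadd n \<mu>0 (vscale n \<sigma> h)"
  let ?e = "vsub n k p"
  have "vinner n (vsub n x p) ?e \<le> 0"
  proof (rule quadratic_nonneg_imp_linear_le)
    fix s :: real assume s: "0 < s" "s \<le> 1"
    define q where "q = vadd n (vscale n (1 - s) p) (vscale n s k)"
    have "q \<in> K" using conv mu_hat_in[of \<sigma> h] k s unfolding vconvex_def q_def p_def by auto
    then have "(vnorm n (vsub n x p))\<^sup>2 \<le> (vnorm n (vsub n x q))\<^sup>2"
      unfolding p_def mu_hat_def x_def by (intro power_mono metric_proj_le[OF closed mu0]) auto
    also have "vnorm n (vsub n x q) = vnorm n (vsub n (vsub n x p) (vscale n s ?e))"
      by (rule L2_set_cong) (auto simp: vsub_def q_def vadd_def vscale_def algebra_simps)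
    finally show "2 * s * vinner n (vsub n x p) ?e \<le> s\<^sup>2 * (vnorm n ?e)\<^sup>2"
      unfolding vnorm_vsub_vscale_power2 by simp
  qed simp
  also have "vinner n (vsub n x p) ?e = vinner n (vsub n (vscale n \<sigma> h) (v \<sigma> h)) (vsub n d (v \<sigma> h))"
    unfolding vinner_def by (rule sum.cong) (auto simp: vsub_def x_def vadd_def vscale_def v_def p_def d_def)
  finally show ?thesis by (simp add: vinner_bilinear vinner_commute[of n _ d])
qed

text \<open>The test point is \<open>\<mu>0 + a * v s g\<close>, in \<open>K\<close> by convexity.
  Freedom in \<open>s\<close>, \<open>g\<close> and \<open>a\<close> allows comparing estimators at
  different noise levels and different noise vectors.\<close>

lemma variational_ineq_scaled:
  assumes "0 \<le> a" "a \<le> 1"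
  shows "a * (\<sigma> * vinner n h (v s g) - vinner n (v \<sigma> h) (v s g)) \<le> \<sigma> * vinner n h (v \<sigma> h) - (vnorm n (v \<sigma> h))\<^sup>2"
proof -
  define k where "k = vadd n (vscale n (1 - a) \<mu>0) (vscale n a (mu_hat n K \<mu>0 s g))"
  have "k \<in> K" using conv mu0 mu_hat_in[of s g] assms unfolding vconvex_def k_def by auto
  moreover have "vsub n k \<mu>0 = vscale n a (v s g)"
    by (auto simp: k_def vsub_def vscale_def vadd_def v_def fun_eq_iff restrict_def algebra_simps)
  ultimately show ?thesis using variational_ineq[of k \<sigma> h]
    by (simp add: vinner_vscale_right vinner_self algebra_simps)
qed

lemma err_eq: "err n K \<mu>0 \<sigma> h = (vnorm n (v \<sigma> h))\<^sup>2"
  by (simp add: err_def v_def)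

lemma dof_eq: "dof n K \<mu>0 \<sigma> h = \<sigma> * vinner n h (v \<sigma> h)"
  by (simp add: dof_def v_def vinner_vscale_right vinner_commute[of n h])

lemma lrt_eq: "lrt n K \<mu>0 \<sigma> h = 2 * \<sigma> * vinner n h (v \<sigma> h) - (vnorm n (v \<sigma> h))\<^sup>2"
proof -
  have *: "vnorm n (vsub n (vadd n \<mu>0 (vscale n \<sigma> h)) (mu_hat n K \<mu>0 \<sigma> h)) = vnorm n (vsub n (vscale n \<sigma> h) (v \<sigma> h))"
    by (rule L2_set_cong) (auto simp: vsub_def vadd_def vscale_def v_def)
  show ?thesis unfolding lrt_def * vinner_self[symmetric]
    by (simp add: vinner_bilinear vinner_commute[of n "v \<sigma> h" h] algebra_simps)
qed

lemma dof_lrt_err: "dof n K \<mu>0 \<sigma> h = (lrt n K \<mu>0 \<sigma> h + err n K \<mu>0 \<sigma> h) / 2"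
  by (simp add: dof_eq lrt_eq err_eq)

lemma err_le_dof: "(vnorm n (v \<sigma> h))\<^sup>2 \<le> \<sigma> * vinner n h (v \<sigma> h)"
  using variational_ineq_scaled[of 0 \<sigma> h \<sigma> h] by simp

text \<open>\<open>lrt\<close> is the maximum of
  \<open>2 * \<sigma> * vinner n h d - (vnorm n d)\<^sup>2\<close> over displacements
  \<open>d\<close> from \<open>\<mu>0\<close> into \<open>K\<close>; here
  \<open>d = a * v s g\<close> is a competitor.\<close>

lemma lrt_ge:
  assumes "0 \<le> a" "a \<le> 1"
  shows "2 * a * \<sigma> * vinner n h (v s g) - a\<^sup>2 * (vnorm n (v s g))\<^sup>2 \<le> lrt n K \<mu>0 \<sigma> h"
proof -
  let ?x = "vnorm n (v \<sigma> h)" and ?y = "vnorm n (v s g)"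
  have "2 * (a * vinner n (v \<sigma> h) (v s g)) \<le> 2 * (a * (?x * ?y))"
    using assms by (intro mult_left_mono vinner_le) auto
  also have "\<dots> \<le> ?x\<^sup>2 + a\<^sup>2 * ?y\<^sup>2"
    using zero_le_power2[of "?x - a * ?y"] by (simp add: power2_eq_square algebra_simps)
  finally show ?thesis unfolding lrt_eq
    using variational_ineq_scaled[OF assms, of \<sigma> h s g] by (simp add: algebra_simps)
qed

text \<open>Firm nonexpansiveness: the variational inequalities at \<open>x\<close> and
  \<open>y\<close>, each tested with the other estimator, are added, and Cauchy-Schwarz cancels one
  factor.\<close>

lemma vnorm_v_lipschitz:
  assumes "0 \<le> \<sigma>"
  shows "\<bar>vnorm n (v \<sigma> x) - vnorm n (v \<sigma> y)\<bar> \<le> \<sigma> * vnorm n (vsub n x y)"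
proof -
  let ?x = "v \<sigma> x" and ?y = "v \<sigma> y"
  have "(vnorm n (vsub n ?x ?y))\<^sup>2 = vinner n ?x ?x - 2 * vinner n ?x ?y + vinner n ?y ?y"
    unfolding vinner_self[symmetric] by (simp add: vinner_bilinear vinner_commute[of n ?y ?x])
  also have "\<dots> \<le> \<sigma> * vinner n (vsub n x y) (vsub n ?x ?y)"
    using variational_ineq_scaled[of 1 \<sigma> x \<sigma> y] variational_ineq_scaled[of 1 \<sigma> y \<sigma> x]
    by (simp add: vinner_bilinear vinner_self vinner_commute[of n ?y ?x] algebra_simps)
  also have "\<dots> \<le> \<sigma> * (vnorm n (vsub n x y) * vnorm n (vsub n ?x ?y))"
    using assms by (intro mult_left_mono vinner_le)
  finally have "vnorm n (vsub n ?x ?y) * vnorm n (vsub n ?x ?y) \<le> (\<sigma> * vnorm n (vsub n x y)) * vnorm n (vsub n ?x ?y)"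
    by (simp add: power2_eq_square mult_ac)
  then have *: "vnorm n (vsub n ?x ?y) \<le> \<sigma> * vnorm n (vsub n x y)"
    using assms by (cases "vnorm n (vsub n ?x ?y) = 0") (auto simp: mult_le_cancel_right less_le)
  have v: "vnorm n (v \<sigma> z) = vnorm n (vsub n (mu_hat n K \<mu>0 \<sigma> z) \<mu>0)" for z by (simp add: v_def)
  have e: "vnorm n (vsub n (v \<sigma> z) (v \<sigma> w)) = vnorm n (vsub n (mu_hat n K \<mu>0 \<sigma> z) (mu_hat n K \<mu>0 \<sigma> w))" for z w
    by (rule L2_set_cong) (auto simp: v_def vsub_def)
  have "vnorm n (v \<sigma> z) \<le> vnorm n (vsub n (v \<sigma> z) (v \<sigma> w)) + vnorm n (v \<sigma> w)" for z w
    unfolding e unfolding v by (rule vnorm_triangle)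
  from this[of x y] this[of y x] * show ?thesis by (simp add: vnorm_vsub_commute[of n ?y ?x])
qed

text \<open>Subgradient inequality for \<open>lrt\<close>, which is a maximum of affine functions of
  the noise: the maximiser for \<open>x\<close> still competes at \<open>y\<close>.\<close>

lemma lrt_diff_le: "lrt n K \<mu>0 \<sigma> x - lrt n K \<mu>0 \<sigma> y \<le> 2 * \<sigma> * vinner n (vsub n x y) (v \<sigma> x)"
  using lrt_ge[of 1 \<sigma> y \<sigma> x] by (simp add: lrt_eq[of \<sigma> x] vinner_vsub_left algebra_simps)

text \<open>Testing each noise level with the other estimator and weighting by \<open>t\<close> and
  \<open>s\<close> cancels the terms in \<open>h\<close>. What remains is
  \<open>(b - a) * (s * b - t * a) \<le> 0\<close>, and for \<open>s \<le> t\<close> either claim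
  failing would make this product positive.\<close>

lemma vnorm_v_sandwich:
  assumes "0 < s" "s \<le> t"
  shows "vnorm n (v s h) \<le> vnorm n (v t h)" "s * vnorm n (v t h) \<le> t * vnorm n (v s h)"
proof -
  define a b where "a = vnorm n (v s h)" and "b = vnorm n (v t h)"
  have ab: "0 \<le> a" "0 \<le> b" by (auto simp: a_def b_def)
  define c where "c = vinner n (v s h) (v t h)"
  have c: "c \<le> a * b" unfolding c_def a_def b_def by (rule vinner_le)
  have 1: "s * (vinner n h (v t h) - vinner n h (v s h)) \<le> c - a\<^sup>2"
    using variational_ineq_scaled[of 1 s h t h] by (simp add: c_def a_def algebra_simps)
  have 2: "t * (vinner n h (v s h) - vinner n h (v t h)) \<le> c - b\<^sup>2"
    using variational_ineq_scaled[of 1 t h s h] by (simp add: c_def b_def vinner_commute[of n "v t h"] algebra_simps)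
  have "t * (s * (vinner n h (v t h) - vinner n h (v s h))) + s * (t * (vinner n h (v s h) - vinner n h (v t h)))
      \<le> t * (c - a\<^sup>2) + s * (c - b\<^sup>2)"
    using 1 2 assms by (intro add_mono mult_left_mono) auto
  then have "t * a\<^sup>2 + s * b\<^sup>2 \<le> (s + t) * c" by (simp add: algebra_simps)
  also have "\<dots> \<le> (s + t) * (a * b)" using c assms by (intro mult_left_mono) auto
  finally have prod: "(b - a) * (s * b - t * a) \<le> 0" by (simp add: power2_eq_square algebra_simps)
  show le: "a \<le> b"
  proof (rule ccontr)
    assume "\<not> a \<le> b"
    moreover from this have "s * b < t * a" using assms ab by (intro mult_le_less_imp_less) auto
    ultimately show False using prod mult_neg_neg[of "b - a" "s * b - t * a"] by simp
  qed
  show "s * b \<le> t * a"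
  proof (rule ccontr)
    assume *: "\<not> s * b \<le> t * a"
    have "s * a \<le> t * a" using assms ab by (intro mult_right_mono) auto
    then have "s * a < s * b" using * by simp
    then have "a < b" using assms by simp
    then have "0 < (b - a) * (s * b - t * a)" using * by (intro mult_pos_pos) auto
    then show False using prod by simp
  qed
qed

lemma sandwich_err: "sandwich (\<lambda>\<sigma>. err n K \<mu>0 \<sigma> h)"
  unfolding sandwich_def err_eq
proof (intro conjI allI impI)
  fix s t :: real assume st: "0 < s" "s \<le> t"
  show "(vnorm n (v s h))\<^sup>2 \<le> (vnorm n (v t h))\<^sup>2"
    by (intro power_mono vnorm_v_sandwich st) simp
  have "vnorm n (v t h) \<le> t / s * vnorm n (v s h)"
    using vnorm_v_sandwich(2)[OF st] st by (simp add: field_simps)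
  then have "(vnorm n (v t h))\<^sup>2 \<le> (t / s * vnorm n (v s h))\<^sup>2" by (intro power_mono) auto
  then show "(vnorm n (v t h))\<^sup>2 \<le> (t / s)\<^sup>2 * (vnorm n (v s h))\<^sup>2" by (simp add: power_mult_distrib power_divide)
qed simp

lemma vinner_v_nonneg: "0 < \<sigma> \<Longrightarrow> 0 \<le> vinner n h (v \<sigma> h)"
  using err_le_dof[of \<sigma> h] by (smt (verit) zero_le_power2 mult_pos_neg)

lemma sandwich_dof: "sandwich (\<lambda>\<sigma>. dof n K \<mu>0 \<sigma> h)"
  unfolding sandwich_def dof_eq
proof (intro conjI allI impI)
  show "0 \<le> s * vinner n h (v s h)" if "0 < s" for s using vinner_v_nonneg[OF that] that by simp
  fix s t :: real assume st: "0 < s" "s \<le> t"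
  define a b where "a = vnorm n (v s h)" and "b = vnorm n (v t h)"
  define c where "c = vinner n (v s h) (v t h)"
  define x y where "x = vinner n h (v s h)" and "y = vinner n h (v t h)"
  have c: "c \<le> a * b" unfolding c_def a_def b_def by (rule vinner_le)
  have xy: "0 \<le> x" using vinner_v_nonneg st unfolding x_def by simp
  have 1: "r * (s * y - c) \<le> s * x - a\<^sup>2" if "0 \<le> r" "r \<le> 1" for r
    using variational_ineq_scaled[OF that, of s h t h] by (simp add: a_def c_def x_def y_def)
  have 2: "t * x - c \<le> t * y - b\<^sup>2"
    using variational_ineq_scaled[of 1 t h s h] by (simp add: b_def c_def x_def y_def vinner_commute[of n "v t h"])
  \<comment> \<open>Adding the two variational inequalities shows that
    \<open>vinner n h (v s h)\<close> is nondecreasing in \<open>s\<close>; monotonicity of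
    \<open>dof\<close> follows.\<close>
  have "0 \<le> (a - b)\<^sup>2" by simp
  then have "2 * c \<le> a\<^sup>2 + b\<^sup>2" using c by (simp add: power2_eq_square algebra_simps)
  then have *: "0 \<le> (t - s) * (y - x)" using 1[of 1] 2 by (simp add: algebra_simps)
  have "s * x \<le> t * y"
  proof (cases "s = t")
    case True
    then show ?thesis by (simp add: x_def y_def)
  next
    case False
    then have "x \<le> y" using * st by (simp add: zero_le_mult_iff)
    then show ?thesis using st xy by (intro mult_mono) auto
  qed
  then show "s * vinner n h (v s h) \<le> t * vinner n h (v t h)" by (simp add: x_def y_def)
  \<comment> \<open>For the growth bound, level \<open>s\<close> is tested with \<open>v t h\<close>
    shrunk by \<open>s / t\<close>; the cross term is absorbed by \<open>a\<^sup>2\<close> because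
    \<open>s * b \<le> t * a\<close>.\<close>
  have "s / t * b \<le> a" using vnorm_v_sandwich(2)[OF st, of h] st by (simp add: a_def b_def field_simps)
  then have "a * (s / t * b) \<le> a * a" by (intro mult_left_mono) (auto simp: a_def)
  moreover have "s / t * c \<le> s / t * (a * b)" using c st by (intro mult_left_mono) auto
  ultimately have "s / t * c \<le> a\<^sup>2" by (simp add: power2_eq_square mult_ac)
  then have "s * (s / t * y) \<le> s * x" using 1[of "s / t"] st by (simp add: algebra_simps)
  then have "s / t * y \<le> x" using st by (simp only: mult_le_cancel_left_pos)
  then have "t\<^sup>2 / s * (s / t * y) \<le> t\<^sup>2 / s * x" using st by (intro mult_left_mono) auto
  then show "t * vinner n h (v t h) \<le> (t / s)\<^sup>2 * (s * vinner n h (v s h))"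
    using st by (simp add: x_def y_def power2_eq_square)
qed

text \<open>Both bounds come from competitors in the variational formula: \<open>v s h\<close> at
  level \<open>t\<close> for monotonicity, and \<open>v t h\<close> shrunk by \<open>s / t\<close>
  at level \<open>s\<close> for the growth bound.\<close>

lemma sandwich_lrt: "sandwich (\<lambda>\<sigma>. lrt n K \<mu>0 \<sigma> h)"
  unfolding sandwich_def
proof (intro conjI allI impI)
  show "0 \<le> lrt n K \<mu>0 s h" if "0 < s" for s using lrt_ge[of 0 s h s h] by simp
  fix s t :: real assume st: "0 < s" "s \<le> t"
  have "s * vinner n h (v s h) \<le> t * vinner n h (v s h)"
    using st vinner_v_nonneg by (intro mult_right_mono) auto
  then show "lrt n K \<mu>0 s h \<le> lrt n K \<mu>0 t h"
    using lrt_ge[of 1 t h s h] by (simp add: lrt_eq[of s])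
  have "(t / s)\<^sup>2 * (2 * (s / t) * s * vinner n h (v t h) - (s / t)\<^sup>2 * (vnorm n (v t h))\<^sup>2)
     \<le> (t / s)\<^sup>2 * lrt n K \<mu>0 s h"
    using st by (intro mult_left_mono lrt_ge) auto
  also have "(t / s)\<^sup>2 * (2 * (s / t) * s * vinner n h (v t h) - (s / t)\<^sup>2 * (vnorm n (v t h))\<^sup>2) = lrt n K \<mu>0 t h"
    using st unfolding lrt_eq by (simp add: power2_eq_square field_simps)
  finally show "lrt n K \<mu>0 t h \<le> (t / s)\<^sup>2 * lrt n K \<mu>0 s h" .
qed

end

section \<open>The tangent cone and the means of the processes\<close>

text \<open>The generating set is stable under nonnegative scaling; since scaling is continuous, so
  is its closure.\<close>

lemma closed_cone_tangent_cone:
  assumes "\<mu>0 \<in> K"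
  shows "closed_cone n (tangent_cone n K \<mu>0)"
    and vscale_in_tangent_cone: "\<And>a \<nu>. 0 \<le> a \<Longrightarrow> \<nu> \<in> K \<Longrightarrow> vscale n a (vsub n \<nu> \<mu>0) \<in> tangent_cone n K \<mu>0"
proof -
  define S where "S = {vscale n \<alpha> (vsub n \<nu> \<mu>0) | \<alpha> \<nu>. 0 \<le> \<alpha> \<and> \<nu> \<in> K}"
  have T: "tangent_cone n K \<mu>0 = euclid_top n closure_of S" by (simp add: tangent_cone_def S_def)
  have "S \<subseteq> topspace (euclid_top n)" by (auto simp: S_def vscale_def split: if_splits)
  then have sub: "S \<subseteq> tangent_cone n K \<mu>0" unfolding T by (rule closure_of_subset)
  then show in_T: "\<And>a \<nu>. 0 \<le> a \<Longrightarrow> \<nu> \<in> K \<Longrightarrow> vscale n a (vsub n \<nu> \<mu>0) \<in> tangent_cone n K \<mu>0"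
    by (auto simp: S_def)
  show "closed_cone n (tangent_cone n K \<mu>0)"
  proof
    show "closedin (euclid_top n) (tangent_cone n K \<mu>0)" unfolding T by simp
    show "tangent_cone n K \<mu>0 \<noteq> {}" using in_T[of 0, OF _ assms] by auto
    fix a x assume a: "(0::real) \<le> a" and x: "x \<in> tangent_cone n K \<mu>0"
    have "continuous_map (euclid_top n) (euclid_top n) (vscale n a)"
      unfolding vscale_def continuous_map_componentwise
      by (auto intro!: continuous_intros continuous_map_product_projection)
    then have "vscale n a ` (euclid_top n closure_of S) \<subseteq> euclid_top n closure_of (vscale n a ` S)"
      by (rule continuous_map_image_closure_subset)
    also have "vscale n a ` S \<subseteq> S"
    proof clarsimp
      fix y assume "y \<in> S"
      then obtain \<alpha> \<nu> where y: "y = vscale n \<alpha> (vsub n \<nu> \<mu>0)" "0 \<le> \<alpha>" "\<nu> \<in> K" by (auto simp: S_def)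
      have "vscale n a y = vscale n (a * \<alpha>) (vsub n \<nu> \<mu>0)" unfolding y by (auto simp: vscale_def fun_eq_iff)
      then show "vscale n a y \<in> S" unfolding S_def using y a by (auto intro!: exI[of _ "a * \<alpha>"])
    qed
    then have "euclid_top n closure_of (vscale n a ` S) \<subseteq> euclid_top n closure_of S" by (rule closure_of_mono)
    finally show "vscale n a x \<in> tangent_cone n K \<mu>0" using x unfolding T by auto
  qed
qed

lemma vnorm_vscale: "0 \<le> a \<Longrightarrow> vnorm n (vscale n a x) = a * vnorm n x"
  by (subst L2_set_right_distrib) (auto simp: vscale_def intro: L2_set_cong)

context projection_process
begin

abbreviation "T \<equiv> tangent_cone n K \<mu>0"
abbreviation "\<delta> \<equiv> stat_dim n T"
abbreviation "pT h \<equiv> metric_proj n T h"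

sublocale tc: closed_cone n T
  by (rule closed_cone_tangent_cone[OF mu0])

lemma v_in_T: "v \<sigma> h \<in> T"
proof -
  have "v \<sigma> h = vscale n 1 (vsub n (mu_hat n K \<mu>0 \<sigma> h) \<mu>0)" by (auto simp: v_def vsub_def vscale_def)
  then show ?thesis using vscale_in_tangent_cone[OF mu0 _ mu_hat_in, of 1] by simp
qed

text \<open>Since \<open>v \<sigma> h\<close> lies in the tangent cone, \<open>err \<le> dof\<close>
  and \<open>vinner_le_proj\<close> bound its squared norm by
  \<open>\<sigma> * vnorm n (pT h) * vnorm n (v \<sigma> h)\<close>; one factor cancels.\<close>

lemma vnorm_v_le: "0 \<le> \<sigma> \<Longrightarrow> vnorm n (v \<sigma> h) \<le> \<sigma> * vnorm n (pT h)"
proof -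
  assume \<sigma>: "0 \<le> \<sigma>"
  have "(vnorm n (v \<sigma> h))\<^sup>2 \<le> \<sigma> * (vnorm n (pT h) * vnorm n (v \<sigma> h))"
    using mult_left_mono[OF tc.vinner_le_proj[OF v_in_T, of h \<sigma> h] \<sigma>] err_le_dof[of \<sigma> h] by simp
  then show ?thesis using \<sigma>
    by (cases "vnorm n (v \<sigma> h) = 0") (auto simp: power2_eq_square less_le mult.assoc[symmetric] mult_le_cancel_right)
qed

lemma dof_le: "0 \<le> \<sigma> \<Longrightarrow> \<sigma> * vinner n h (v \<sigma> h) \<le> \<sigma>\<^sup>2 * (vnorm n (pT h))\<^sup>2"
proof -
  assume \<sigma>: "0 \<le> \<sigma>"
  have "\<sigma> * vinner n h (v \<sigma> h) \<le> \<sigma> * (vnorm n (pT h) * vnorm n (v \<sigma> h))"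
    by (rule mult_left_mono[OF tc.vinner_le_proj[OF v_in_T] \<sigma>])
  also have "\<dots> \<le> \<sigma> * (vnorm n (pT h) * (\<sigma> * vnorm n (pT h)))"
    using \<sigma> by (intro mult_left_mono vnorm_v_le) auto
  finally show ?thesis by (simp add: power2_eq_square mult_ac)
qed

abbreviation "processes \<equiv> {err n K \<mu>0, lrt n K \<mu>0, dof n K \<mu>0}"

lemma process_sandwich: "H \<in> processes \<Longrightarrow> sandwich (\<lambda>\<sigma>. H \<sigma> h)"
  using sandwich_err sandwich_lrt sandwich_dof by auto

lemma process_nonneg: "H \<in> processes \<Longrightarrow> 0 < \<sigma> \<Longrightarrow> 0 \<le> H \<sigma> h"
  using process_sandwich unfolding sandwich_def by blast

text \<open>The factor 2 comes from \<open>lrt = 2 * dof - err\<close>; \<open>err\<close> and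
  \<open>dof\<close> are at most \<open>q\<close>.\<close>

lemma process_le:
  assumes "H \<in> processes" "0 < \<sigma>"
  shows "H \<sigma> h \<le> 2 * \<sigma>\<^sup>2 * (vnorm n (pT h))\<^sup>2"
proof -
  define q where "q = \<sigma>\<^sup>2 * (vnorm n (pT h))\<^sup>2"
  define w where "w = (vnorm n (v \<sigma> h))\<^sup>2"
  have "0 \<le> w" "0 \<le> q" by (simp_all add: q_def w_def)
  moreover have "\<sigma> * vinner n h (v \<sigma> h) \<le> q" using dof_le[of \<sigma> h] assms(2) by (simp add: q_def)
  moreover note err_le_dof[of \<sigma> h, folded w_def]
  ultimately have "H \<sigma> h \<le> 2 * q"
    using assms(1) by (auto simp: err_eq dof_eq lrt_eq mult.assoc w_def[symmetric])
  then show ?thesis by (simp add: q_def)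
qed

lemma measurable_vnorm_v: "0 \<le> \<sigma> \<Longrightarrow> (\<lambda>h. vnorm n (v \<sigma> h)) \<in> borel_measurable (std_gaussian n)"
  by (rule borel_measurable_lipschitz[OF vnorm_v_lipschitz])

text \<open>\<open>err\<close> and \<open>lrt\<close> are built from Lipschitz functions of the
  noise, namely the norm of \<open>v\<close> and the distance to \<open>K\<close>;
  \<open>dof\<close> is half their sum.\<close>

lemma measurable_process:
  assumes H: "H \<in> processes" and \<sigma>: "0 \<le> \<sigma>"
  shows "H \<sigma> \<in> borel_measurable (std_gaussian n)"
proof -
  let ?x = "\<lambda>h. vadd n \<mu>0 (vscale n \<sigma> h)"
  have "vnorm n (vsub n (?x h) (?x g)) = vnorm n (vscale n \<sigma> (vsub n h g))" for h g
    by (rule L2_set_cong) (auto simp: vsub_def vadd_def vscale_def algebra_simps)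
  then have "vnorm n (vsub n (?x h) (?x g)) = \<sigma> * vnorm n (vsub n h g)" for h g
    by (simp add: vnorm_vscale \<sigma>)
  then have [measurable]: "(\<lambda>h. vnorm n (vsub n (?x h) (mu_hat n K \<mu>0 \<sigma> h))) \<in> borel_measurable (std_gaussian n)"
    unfolding mu_hat_def
    by (intro borel_measurable_lipschitz[where L = \<sigma>]) (metis dist_metric_proj_lipschitz[OF closed mu0])
  have err: "err n K \<mu>0 \<sigma> \<in> borel_measurable (std_gaussian n)"
    unfolding err_eq[abs_def] by (intro borel_measurable_power measurable_vnorm_v \<sigma>)
  have lrt: "lrt n K \<mu>0 \<sigma> \<in> borel_measurable (std_gaussian n)"
    unfolding lrt_def[abs_def] vnorm_vscale[OF \<sigma>] by measurable
  have "dof n K \<mu>0 \<sigma> \<in> borel_measurable (std_gaussian n)"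
    unfolding dof_lrt_err[abs_def] using err lrt by measurable
  then show ?thesis using H err lrt by auto
qed

lemma integrable_process:
  assumes H: "H \<in> processes" and \<sigma>: "0 < \<sigma>"
  shows "integrable (std_gaussian n) (H \<sigma>)"
proof (rule Bochner_Integration.integrable_bound)
  show "integrable (std_gaussian n) (\<lambda>h. 2 * \<sigma>\<^sup>2 * (vnorm n (pT h))\<^sup>2)"
    using tc.integrable_proj by simp
  show "H \<sigma> \<in> borel_measurable (std_gaussian n)" using measurable_process[OF H] \<sigma> by simp
  show "AE h in std_gaussian n. norm (H \<sigma> h) \<le> norm (2 * \<sigma>\<^sup>2 * (vnorm n (pT h))\<^sup>2)"
    using process_le[OF H \<sigma>] process_nonneg[OF H \<sigma>] by (intro AE_I2) simp
qed

abbreviation EE :: "(real \<Rightarrow> (nat \<Rightarrow> real) \<Rightarrow> real) \<Rightarrow> real \<Rightarrow> real" where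
  "EE H \<sigma> \<equiv> \<integral>g. H \<sigma> g \<partial>std_gaussian n"

lemma EE_sandwich:
  assumes H: "H \<in> processes"
  shows "sandwich (EE H)"
  unfolding sandwich_def
proof (intro conjI allI impI)
  show "0 \<le> EE H s" if "0 < s" for s by (intro integral_nonneg_AE AE_I2 process_nonneg H that)
  fix s t :: real assume st: "0 < s" "s \<le> t"
  have sw: "H s h \<le> H t h" "H t h \<le> (t / s)\<^sup>2 * H s h" for h
    using process_sandwich[OF H, of h] st unfolding sandwich_def by blast+
  have t: "0 < t" using st by simp
  show "EE H s \<le> EE H t" by (intro integral_mono integrable_process H st t sw)
  have "EE H t \<le> (\<integral>g. (t / s)\<^sup>2 * H s g \<partial>std_gaussian n)"
    using t st by (intro integral_mono integrable_mult_right integrable_process H sw)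
  then show "EE H t \<le> (t / s)\<^sup>2 * EE H s" by simp
qed

lemma EE_le:
  assumes H: "H \<in> processes" and \<sigma>: "0 < \<sigma>"
  shows "EE H \<sigma> \<le> 2 * \<sigma>\<^sup>2 * \<delta>"
proof -
  have "EE H \<sigma> \<le> (\<integral>h. 2 * \<sigma>\<^sup>2 * (vnorm n (pT h))\<^sup>2 \<partial>std_gaussian n)"
    by (intro integral_mono integrable_process H \<sigma> process_le integrable_mult_right tc.integrable_proj)
  then show ?thesis by (simp add: stat_dim_def)
qed

abbreviation "m \<sigma> \<equiv> \<integral>h. vnorm n (v \<sigma> h) \<partial>std_gaussian n"

lemma integrable_vnorm_v:
  assumes \<sigma>: "0 < \<sigma>"
  shows "integrable (std_gaussian n) (\<lambda>h. vnorm n (v \<sigma> h))"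
proof (rule Bochner_Integration.integrable_bound)
  show "integrable (std_gaussian n) (\<lambda>h. 1 + err n K \<mu>0 \<sigma> h)"
    using integrable_process[of "err n K \<mu>0", OF _ \<sigma>] by simp
  show "(\<lambda>h. vnorm n (v \<sigma> h)) \<in> borel_measurable (std_gaussian n)" using measurable_vnorm_v \<sigma> by simp
  have "x \<le> 1 + x\<^sup>2" for x :: real using zero_le_power2[of "x - 1 / 2"]
    by (simp add: power2_eq_square algebra_simps)
  then show "AE h in std_gaussian n. norm (vnorm n (v \<sigma> h)) \<le> norm (1 + err n K \<mu>0 \<sigma> h)"
    by (intro AE_I2) (simp add: err_eq)
qed

text \<open>Supplies the hypothesis of the concentration inequality: the Lipschitz bound followed by
  \<open>l * \<sigma> * d \<le> (l * \<sigma>)\<^sup>2 + d\<^sup>2 / 4\<close>.\<close>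

lemma vnorm_v_diff_le:
  assumes "0 < \<sigma>" "0 \<le> l"
  shows "\<bar>l * vnorm n (v \<sigma> x) - l * vnorm n (v \<sigma> y)\<bar> \<le> l\<^sup>2 * \<sigma>\<^sup>2 + (vnorm n (vsub n x y))\<^sup>2 / 4"
proof -
  have "\<bar>l * vnorm n (v \<sigma> x) - l * vnorm n (v \<sigma> y)\<bar> = l * \<bar>vnorm n (v \<sigma> x) - vnorm n (v \<sigma> y)\<bar>"
    using assms by (simp add: abs_mult flip: right_diff_distrib)
  also have "\<dots> \<le> l * (\<sigma> * vnorm n (vsub n x y))"
    using assms by (intro mult_left_mono vnorm_v_lipschitz) auto
  also have "\<dots> \<le> l\<^sup>2 * \<sigma>\<^sup>2 + (vnorm n (vsub n x y))\<^sup>2 / 4"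
    using zero_le_power2[of "l * \<sigma> - vnorm n (vsub n x y) / 2"] by (simp add: power2_eq_square algebra_simps)
  finally show ?thesis .
qed

text \<open>Lets \<open>m \<sigma>\<close> and the root of the mean error replace each other up to
  \<open>O(\<sigma>)\<close>. The lower bound on the mean error is nonnegativity of the variance;
  the upper one bounds the square of the standardised variable \<open>?z\<close> by its two
  exponential moments.\<close>

lemma variance_vnorm_v:
  assumes \<sigma>: "0 < \<sigma>"
  shows "(m \<sigma>)\<^sup>2 \<le> EE (err n K \<mu>0) \<sigma>" "EE (err n K \<mu>0) \<sigma> \<le> (m \<sigma>)\<^sup>2 + 12 * \<sigma>\<^sup>2"
proof -
  let ?G = "\<lambda>h. vnorm n (v \<sigma> h)"
  note int1 = integrable_vnorm_v[OF \<sigma>]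
  have int2: "integrable (std_gaussian n) (\<lambda>h. (?G h)\<^sup>2)"
    using integrable_process[of "err n K \<mu>0", OF _ \<sigma>] by (simp add: err_eq[abs_def])
  have eq: "(\<lambda>h. (?G h - m \<sigma>)\<^sup>2) = (\<lambda>h. (?G h)\<^sup>2 - 2 * m \<sigma> * ?G h + (m \<sigma>)\<^sup>2)"
    by (simp add: power2_eq_square algebra_simps)
  have int3: "integrable (std_gaussian n) (\<lambda>h. (?G h - m \<sigma>)\<^sup>2)"
    unfolding eq using int1 int2 by simp
  have var: "(\<integral>h. (?G h - m \<sigma>)\<^sup>2 \<partial>std_gaussian n) = EE (err n K \<mu>0) \<sigma> - (m \<sigma>)\<^sup>2"
    unfolding eq err_eq[abs_def] using int1 int2 by (simp add: gauss.prob_space power2_eq_square)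
  have "0 \<le> (\<integral>h. (?G h - m \<sigma>)\<^sup>2 \<partial>std_gaussian n)" by simp
  then show "(m \<sigma>)\<^sup>2 \<le> EE (err n K \<mu>0) \<sigma>" using var by simp
  have [measurable]: "?G \<in> borel_measurable (std_gaussian n)" using int1 by simp
  let ?z = "\<lambda>h. (?G h - m \<sigma>) / \<sigma>"
  have dl: "\<bar>?G x / \<sigma> - ?G y / \<sigma>\<bar> \<le> 1 + (vnorm n (vsub n x y))\<^sup>2 / 4" for x y
    using vnorm_v_diff_le[OF \<sigma>, of "1 / \<sigma>" x y] \<sigma> by (simp add: power_divide)
  have e1: "(\<integral>\<^sup>+h. ennreal (exp (?z h - 1)) \<partial>std_gaussian n) \<le> 1"
    using gauss_exp_bound[of n "\<lambda>h. ?G h / \<sigma>" "\<lambda>_. 1"] int1 abs_le_D1[OF dl] by (simp add: diff_divide_distrib)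
  have "(\<integral>\<^sup>+h. ennreal (exp (- ?G h / \<sigma> - (\<integral>h. - ?G h / \<sigma> \<partial>std_gaussian n) - 1)) \<partial>std_gaussian n) \<le> 1"
    by (rule gauss_exp_bound) (use int1 abs_le_D2[OF dl] in auto)
  then have e2: "(\<integral>\<^sup>+h. ennreal (exp (- ?z h - 1)) \<partial>std_gaussian n) \<le> 1"
    by (simp add: diff_divide_distrib)
  \<comment> \<open>The constant 6 is 2 from \<open>z\<^sup>2 / 2 \<le> exp \<bar>z\<bar>\<close>
    times 3 from \<open>exp 1 \<le> 3\<close>.\<close>
  have pw: "z\<^sup>2 \<le> 6 * (exp (z - 1) + exp (- z - 1))" for z :: real
  proof -
    have "z\<^sup>2 / 2 \<le> exp \<bar>z\<bar>" using exp_lower_Taylor_quadratic[of "\<bar>z\<bar>"] by simp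
    also have "\<dots> \<le> exp z + exp (- z)" by (simp add: abs_if)
    also have "\<dots> = exp 1 * (exp (z - 1) + exp (- z - 1))" by (simp add: distrib_left flip: exp_add)
    also have "\<dots> \<le> 3 * (exp (z - 1) + exp (- z - 1))" using exp_le by (intro mult_right_mono) auto
    finally show ?thesis by simp
  qed
  have "ennreal (\<integral>h. (?z h)\<^sup>2 \<partial>std_gaussian n) = (\<integral>\<^sup>+h. ennreal ((?z h)\<^sup>2) \<partial>std_gaussian n)"
    using int3 by (intro nn_integral_eq_integral[symmetric]) (auto simp: power_divide)
  also have "\<dots> \<le> (\<integral>\<^sup>+h. 6 * (ennreal (exp (?z h - 1)) + ennreal (exp (- ?z h - 1))) \<partial>std_gaussian n)"
  proof (rule nn_integral_mono)
    fix h
    have "ennreal ((?z h)\<^sup>2) \<le> ennreal (6 * (exp (?z h - 1) + exp (- ?z h - 1)))" by (intro ennreal_leI pw)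
    also have "\<dots> = 6 * (ennreal (exp (?z h - 1)) + ennreal (exp (- ?z h - 1)))"
      by (simp add: ennreal_mult)
    finally show "ennreal ((?z h)\<^sup>2) \<le> \<dots>" .
  qed
  also have "\<dots> = 6 * ((\<integral>\<^sup>+h. ennreal (exp (?z h - 1)) \<partial>std_gaussian n) + (\<integral>\<^sup>+h. ennreal (exp (- ?z h - 1)) \<partial>std_gaussian n))"
    by (simp add: nn_integral_add nn_integral_cmult distrib_left)
  also have "\<dots> \<le> 6 * (1 + 1)" by (intro mult_left_mono add_mono e1 e2) auto
  also have "\<dots> = ennreal 12" by simp
  finally have "(\<integral>h. (?z h)\<^sup>2 \<partial>std_gaussian n) \<le> 12" by (subst (asm) ennreal_le_iff) simp_all
  then show "EE (err n K \<mu>0) \<sigma> \<le> (m \<sigma>)\<^sup>2 + 12 * \<sigma>\<^sup>2"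
    using \<sigma> unfolding power_divide by (simp add: var pos_divide_le_eq)
qed

section \<open>Pointwise concentration\<close>

text \<open>The right-hand side may depend on \<open>x\<close> only, so the increment whose
  subgradient sits at \<open>y\<close> is moved to \<open>x\<close> by the Lipschitz bound on the
  norm of \<open>v\<close>. The smallness of \<open>l\<close> pays for the resulting quadratic term
  in \<open>d\<close>.\<close>

lemma lrt_scaled_diff_le:
  assumes \<sigma>: "0 < \<sigma>" and l: "0 < l" "16 * l * \<sigma>\<^sup>2 \<le> 1"
  shows "\<bar>l * lrt n K \<mu>0 \<sigma> x - l * lrt n K \<mu>0 \<sigma> y\<bar>
    \<le> 8 * l\<^sup>2 * \<sigma>\<^sup>2 * (vnorm n (v \<sigma> x))\<^sup>2 + (vnorm n (vsub n x y))\<^sup>2 / 4"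
proof -
  define a d where "a = vnorm n (v \<sigma> x)" and "d = vnorm n (vsub n x y)"
  have ad: "0 \<le> a" "0 \<le> d" by (auto simp: a_def d_def)
  have up: "lrt n K \<mu>0 \<sigma> x' - lrt n K \<mu>0 \<sigma> y' \<le> 2 * \<sigma> * (d * vnorm n (v \<sigma> x'))"
    if "vnorm n (vsub n x' y') = d" for x' y'
  proof -
    have "2 * \<sigma> * vinner n (vsub n x' y') (v \<sigma> x') \<le> 2 * \<sigma> * (d * vnorm n (v \<sigma> x'))"
      using vinner_le[of n "vsub n x' y'" "v \<sigma> x'"] \<sigma> that by (intro mult_left_mono) auto
    then show ?thesis using lrt_diff_le[of \<sigma> x' y'] by linarith
  qed
  have 1: "lrt n K \<mu>0 \<sigma> x - lrt n K \<mu>0 \<sigma> y \<le> 2 * \<sigma> * (d * (a + \<sigma> * d))"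
  proof -
    have "2 * \<sigma> * (d * a) \<le> 2 * \<sigma> * (d * (a + \<sigma> * d))" using ad \<sigma> by (intro mult_left_mono) auto
    then show ?thesis using up[of x y] by (simp add: a_def d_def)
  qed
  have "vnorm n (v \<sigma> y) \<le> a + \<sigma> * d" using vnorm_v_lipschitz[of \<sigma> x y] \<sigma> by (simp add: a_def d_def)
  then have "2 * \<sigma> * (d * vnorm n (v \<sigma> y)) \<le> 2 * \<sigma> * (d * (a + \<sigma> * d))"
    using ad \<sigma> by (intro mult_left_mono) auto
  then have 2: "lrt n K \<mu>0 \<sigma> y - lrt n K \<mu>0 \<sigma> x \<le> 2 * \<sigma> * (d * (a + \<sigma> * d))"
    using up[of y x] by (simp add: d_def vnorm_vsub_commute[of n y x])
  have "\<bar>l * lrt n K \<mu>0 \<sigma> x - l * lrt n K \<mu>0 \<sigma> y\<bar> = l * \<bar>lrt n K \<mu>0 \<sigma> x - lrt n K \<mu>0 \<sigma> y\<bar>"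
    using l by (simp add: abs_mult flip: right_diff_distrib)
  also have "\<dots> \<le> l * (2 * \<sigma> * (d * (a + \<sigma> * d)))" using 1 2 l by (intro mult_left_mono) auto
  \<comment> \<open>The allowance \<open>d\<^sup>2 / 4\<close> is split evenly between the linear
    and the quadratic term.\<close>
  also have "\<dots> = 2 * (l * \<sigma> * a) * d + (16 * l * \<sigma>\<^sup>2) * (d\<^sup>2 / 8)" by (simp add: power2_eq_square algebra_simps)
  also have "\<dots> \<le> (8 * (l * \<sigma> * a)\<^sup>2 + d\<^sup>2 / 8) + 1 * (d\<^sup>2 / 8)"
  proof (intro add_mono mult_right_mono l)
    have "0 \<le> (8 * (l * \<sigma> * a) - d)\<^sup>2" by simp
    then show "2 * (l * \<sigma> * a) * d \<le> 8 * (l * \<sigma> * a)\<^sup>2 + d\<^sup>2 / 8"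
      by (simp add: power2_eq_square algebra_simps)
  qed simp
  finally show ?thesis by (simp add: a_def d_def power_mult_distrib mult_ac)
qed

definition dev :: "real \<Rightarrow> real \<Rightarrow> real" where
  "dev t \<sigma> = \<sigma> * sqrt (EE (err n K \<mu>0) \<sigma>) * sqrt t + \<sigma>\<^sup>2 * t"

text \<open>One exceptional event serves all three processes. It consists of the two tails of
  \<open>vnorm n (v \<sigma> h)\<close>, which control \<open>err\<close>, and the two tails of
  \<open>lrt\<close>; \<open>dof\<close> is the average of \<open>err\<close> and
  \<open>lrt\<close>.\<close>

lemma concentration_at:
  assumes \<sigma>: "0 < \<sigma>" and t: "1 \<le> t"
  obtains B where "B \<in> sets (std_gaussian n)" "measure (std_gaussian n) B \<le> 4 * exp (- t)"
    "\<And>h H. h \<in> space (std_gaussian n) \<Longrightarrow> h \<notin> B \<Longrightarrow> H \<in> processes \<Longrightarrow> \<bar>H \<sigma> h - EE H \<sigma>\<bar> \<le> 20 * dev t \<sigma>"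
proof -
  let ?M = "std_gaussian n" and ?G = "\<lambda>h. vnorm n (v \<sigma> h)" and ?L = "lrt n K \<mu>0 \<sigma>"
  define e s a where "e = sqrt (EE (err n K \<mu>0) \<sigma>)" and "s = sqrt t" and "a = \<sigma> * s"
  \<comment> \<open>balances the two terms \<open>8 l \<sigma>\<^sup>2 err\<close> and \<open>t / l\<close> of the tail bound for \<open>lrt\<close>\<close>
  define l where "l = s / (16 * \<sigma> * (e + a))"
  have s: "1 \<le> s" "s\<^sup>2 = t" using t by (auto simp: s_def)
  have a: "0 < a" "\<sigma> \<le> a" using s \<sigma> by (auto simp: a_def)
  have E0: "0 \<le> EE (err n K \<mu>0) \<sigma>" using EE_sandwich[of "err n K \<mu>0"] \<sigma> by (simp add: sandwich_def)
  then have e: "0 \<le> e" "e\<^sup>2 = EE (err n K \<mu>0) \<sigma>" by (auto simp: e_def)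
  have l: "0 < l" using s \<sigma> a e by (auto simp: l_def)
  have l16: "16 * l * \<sigma>\<^sup>2 \<le> 1"
  proof -
    have "16 * l * \<sigma>\<^sup>2 = a / (e + a)" using \<sigma> by (simp add: l_def a_def power2_eq_square)
    then show ?thesis using a e by simp
  qed
  note intG = integrable_vnorm_v[OF \<sigma>] and intL = integrable_process[of "lrt n K \<mu>0", simplified, OF \<sigma>]
  have [measurable]: "?G \<in> borel_measurable ?M" "?L \<in> borel_measurable ?M" using intG intL by auto
  \<comment> \<open>This scale equates \<open>R = k\<^sup>2 * \<sigma>\<^sup>2\<close> with
    \<open>t\<close>, so the norm deviates from its mean by at most
    \<open>2 * t / k = 2 * a\<close>.\<close>
  define k where "k = s / \<sigma>"
  have k: "0 < k" "k\<^sup>2 * \<sigma>\<^sup>2 = t" using s \<sigma> by (auto simp: k_def power_divide)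
  define B1 where "B1 = {h \<in> space ?M. k\<^sup>2 * \<sigma>\<^sup>2 + t < k * ?G h - (\<integral>h. k * ?G h \<partial>?M)}"
  define B2 where "B2 = {h \<in> space ?M. k\<^sup>2 * \<sigma>\<^sup>2 + t < - k * ?G h - (\<integral>h. - k * ?G h \<partial>?M)}"
  define B3 where "B3 = {h \<in> space ?M. 8 * l\<^sup>2 * \<sigma>\<^sup>2 * (?G h)\<^sup>2 + t < l * ?L h - (\<integral>h. l * ?L h \<partial>?M)}"
  define B4 where "B4 = {h \<in> space ?M. 8 * l\<^sup>2 * \<sigma>\<^sup>2 * (?G h)\<^sup>2 + t < - l * ?L h - (\<integral>h. - l * ?L h \<partial>?M)}"
  have Bs: "B1 \<in> sets ?M" "B2 \<in> sets ?M" "B3 \<in> sets ?M" "B4 \<in> sets ?M"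
    unfolding B1_def B2_def B3_def B4_def by measurable
  have kd: "\<bar>k * ?G x - k * ?G y\<bar> \<le> k\<^sup>2 * \<sigma>\<^sup>2 + (vnorm n (vsub n x y))\<^sup>2 / 4" for x y
    using vnorm_v_diff_le[OF \<sigma>, of k] k by simp
  note ld = lrt_scaled_diff_le[OF \<sigma> l l16]
  have m1: "measure ?M B1 \<le> exp (- t)" unfolding B1_def
    by (rule gauss_tail) (use intG abs_le_D1[OF kd] in auto)
  have m2: "measure ?M B2 \<le> exp (- t)" unfolding B2_def
    by (rule gauss_tail) (use intG abs_le_D2[OF kd] in auto)
  have m3: "measure ?M B3 \<le> exp (- t)" unfolding B3_def
    by (rule gauss_tail) (use intL abs_le_D1[OF ld] in auto)
  have m4: "measure ?M B4 \<le> exp (- t)" unfolding B4_def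
    by (rule gauss_tail) (use intL abs_le_D2[OF ld] in auto)
  define B where "B = (B1 \<union> B2) \<union> (B3 \<union> B4)"
  have "measure ?M B \<le> (measure ?M B1 + measure ?M B2) + (measure ?M B3 + measure ?M B4)"
    unfolding B_def using Bs by (intro order_trans[OF measure_Un_le add_mono[OF measure_Un_le measure_Un_le]]) auto
  then have mB: "measure ?M B \<le> 4 * exp (- t)" using m1 m2 m3 m4 by simp
  have dev_eq: "dev t \<sigma> = e * a + a\<^sup>2"
    using s by (simp add: dev_def e_def[symmetric] s_def[symmetric] a_def power_mult_distrib)
  note mm = variance_vnorm_v[OF \<sigma>, folded e(2)]
  have m0: "0 \<le> m \<sigma>" by (intro integral_nonneg_AE) simp
  have me: "m \<sigma> \<le> e" using mm(1) e(1) by (rule power2_le_imp_le)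
  have good: "\<bar>H \<sigma> h - EE H \<sigma>\<bar> \<le> 20 * dev t \<sigma>"
    if h: "h \<in> space ?M" "h \<notin> B" and H: "H \<in> processes" for h H
  proof -
    have nB: "h \<notin> B1" "h \<notin> B2" "h \<notin> B3" "h \<notin> B4" using h by (auto simp: B_def)
    define g L where "g = ?G h" and "L = ?L h"
    have g0: "0 \<le> g" by (simp add: g_def)
    have "k * (g - m \<sigma>) \<le> 2 * t" using nB(1) h(1) k by (simp add: B1_def g_def algebra_simps)
    moreover have "k * (m \<sigma> - g) \<le> 2 * t" using nB(2) h(1) k by (simp add: B2_def g_def algebra_simps)
    moreover have "2 * t = k * (2 * a)" using \<sigma> s by (simp add: k_def a_def power2_eq_square)
    ultimately have gm: "g - m \<sigma> \<le> 2 * a" "m \<sigma> - g \<le> 2 * a" using k(1) by (auto simp only: mult_le_cancel_left_pos)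
    have ma: "m \<sigma> * a \<le> e * a" using me a by (intro mult_right_mono) auto
    have "\<sigma>\<^sup>2 \<le> a\<^sup>2" using a \<sigma> by (intro power_mono) auto
    then have e2: "e\<^sup>2 \<le> (m \<sigma>)\<^sup>2 + 12 * a\<^sup>2" using mm(2) by simp
    have "g\<^sup>2 \<le> (m \<sigma> + 2 * a)\<^sup>2" using gm g0 by (intro power_mono) auto
    then have up: "g\<^sup>2 - e\<^sup>2 \<le> 4 * (e * a) + 4 * a\<^sup>2"
      using mm(1) ma by (simp add: power2_sum algebra_simps power_mult_distrib)
    \<comment> \<open>Squaring \<open>m \<sigma> - 2 * a \<le> g\<close> requires a nonnegative left
      side; otherwise the claimed lower bound is itself nonpositive.\<close>
    have "(m \<sigma>)\<^sup>2 - 4 * (m \<sigma> * a) \<le> g\<^sup>2"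
    proof (cases "m \<sigma> \<le> 2 * a")
      case True
      then have "m \<sigma> * m \<sigma> \<le> m \<sigma> * (2 * a)" using m0 by (intro mult_left_mono) auto
      then have "(m \<sigma>)\<^sup>2 \<le> 2 * (m \<sigma> * a)" by (simp add: power2_eq_square)
      moreover have "0 \<le> m \<sigma> * a" "0 \<le> g\<^sup>2" using m0 a by auto
      ultimately show ?thesis by linarith
    next
      case False
      then have "(m \<sigma> - 2 * a)\<^sup>2 \<le> g\<^sup>2" using gm by (intro power_mono) auto
      then have "(m \<sigma>)\<^sup>2 - 4 * (m \<sigma> * a) + 4 * a\<^sup>2 \<le> g\<^sup>2" by (simp add: power2_diff power_mult_distrib)
      moreover have "0 \<le> a\<^sup>2" by simp
      ultimately show ?thesis by linarith
    qed
    then have lo: "e\<^sup>2 - g\<^sup>2 \<le> 4 * (e * a) + 12 * a\<^sup>2" using e2 ma by linarith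
    have ea0: "0 \<le> e * a" "0 \<le> a\<^sup>2" using e a by auto
    have err: "\<bar>g\<^sup>2 - e\<^sup>2\<bar> \<le> 16 * dev t \<sigma>" unfolding dev_eq distrib_left using up lo ea0 by arith
    \<comment> \<open>Off \<open>B1\<close> the random threshold in the tail bound for
      \<open>lrt\<close> becomes deterministic.\<close>
    have "g\<^sup>2 \<le> (2 * (e + a))\<^sup>2" using gm me a g0 e(1) by (intro power_mono) auto
    then have g2: "g\<^sup>2 \<le> 4 * (e + a)\<^sup>2" by (simp only: power_mult_distrib) simp
    have lrel: "l * (16 * \<sigma> * (e + a)) = s" using \<sigma> a e by (simp add: l_def)
    have "l * (L - EE (lrt n K \<mu>0) \<sigma>) \<le> 8 * l\<^sup>2 * \<sigma>\<^sup>2 * g\<^sup>2 + t"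
      using nB(3) h(1) by (simp add: B3_def L_def g_def right_diff_distrib)
    moreover have "l * (EE (lrt n K \<mu>0) \<sigma> - L) \<le> 8 * l\<^sup>2 * \<sigma>\<^sup>2 * g\<^sup>2 + t"
      using nB(4) h(1) by (simp add: B4_def L_def g_def right_diff_distrib)
    ultimately have "l * \<bar>L - EE (lrt n K \<mu>0) \<sigma>\<bar> \<le> 8 * l\<^sup>2 * \<sigma>\<^sup>2 * g\<^sup>2 + t"
      by (simp add: abs_if)
    also have "\<dots> \<le> 8 * l\<^sup>2 * \<sigma>\<^sup>2 * (4 * (e + a)\<^sup>2) + t" using g2 by (intro add_mono mult_left_mono) auto
    \<comment> \<open>By the choice of \<open>l\<close> the two terms become 2 and 16 times
      \<open>l * a * (e + a)\<close>, that is 18 times \<open>l * dev t \<sigma>\<close>.\<close>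
    also have "8 * l\<^sup>2 * \<sigma>\<^sup>2 * (4 * (e + a)\<^sup>2) = l * (2 * \<sigma> * (e + a)) * (l * (16 * \<sigma> * (e + a)))"
      by (simp add: power2_eq_square algebra_simps)
    also have "\<dots> = l * (2 * a * (e + a))" unfolding lrel by (simp add: a_def)
    also have "t = (l * (16 * \<sigma> * (e + a))) * s" unfolding lrel using s by (simp add: power2_eq_square)
    also have "\<dots> = l * (16 * a * (e + a))" by (simp add: a_def)
    finally have "l * \<bar>L - EE (lrt n K \<mu>0) \<sigma>\<bar> \<le> l * (18 * dev t \<sigma>)"
      by (simp add: dev_eq algebra_simps power2_eq_square)
    then have lrt: "\<bar>L - EE (lrt n K \<mu>0) \<sigma>\<bar> \<le> 18 * dev t \<sigma>" using l by (simp only: mult_le_cancel_left_pos)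
    have "EE (dof n K \<mu>0) \<sigma> = (EE (lrt n K \<mu>0) \<sigma> + e\<^sup>2) / 2"
      unfolding dof_lrt_err[abs_def] e(2) using intL integrable_process[of "err n K \<mu>0", simplified, OF \<sigma>] by simp
    moreover have "dof n K \<mu>0 \<sigma> h = (L + g\<^sup>2) / 2" by (simp add: dof_lrt_err L_def g_def err_eq)
    ultimately have dof: "\<bar>dof n K \<mu>0 \<sigma> h - EE (dof n K \<mu>0) \<sigma>\<bar> \<le> 17 * dev t \<sigma>"
      using err lrt by (simp add: abs_le_iff)
    have "err n K \<mu>0 \<sigma> h = g\<^sup>2" by (simp add: err_eq g_def)
    moreover have "0 \<le> dev t \<sigma>" using ea0 by (simp add: dev_eq)
    ultimately show ?thesis using H err lrt dof by (auto simp: L_def[symmetric] e(2))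
  qed
  have "B \<in> sets ?M" using Bs by (auto simp: B_def)
  from that[OF this mB] good show thesis by blast
qed

section \<open>Uniform concentration\<close>

lemma dev_mono:
  assumes "0 < s" "s \<le> r" "1 \<le> t"
  shows "dev t s \<le> dev t r" "dev t r \<le> (r / s)\<^sup>2 * dev t s"
proof -
  have sw: "EE (err n K \<mu>0) s \<le> EE (err n K \<mu>0) r" "EE (err n K \<mu>0) r \<le> (r / s)\<^sup>2 * EE (err n K \<mu>0) s"
    and nn: "0 \<le> EE (err n K \<mu>0) s" "0 \<le> EE (err n K \<mu>0) r"
    using EE_sandwich[of "err n K \<mu>0"] assms unfolding sandwich_def by auto
  show "dev t s \<le> dev t r" unfolding dev_def
    using assms sw nn by (intro add_mono mult_mono power_mono) auto
  have "sqrt (EE (err n K \<mu>0) r) \<le> sqrt ((r / s)\<^sup>2 * EE (err n K \<mu>0) s)" using sw(2) by (rule real_sqrt_le_mono)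
  also have "\<dots> = r / s * sqrt (EE (err n K \<mu>0) s)" using assms by (simp add: real_sqrt_mult)
  finally have "r * sqrt (EE (err n K \<mu>0) r) * sqrt t + r\<^sup>2 * t \<le> r * (r / s * sqrt (EE (err n K \<mu>0) s)) * sqrt t + r\<^sup>2 * t"
    using assms by (intro add_mono mult_right_mono mult_left_mono) auto
  also have "\<dots> = (r / s)\<^sup>2 * dev t s" using assms unfolding dev_def by (simp add: power2_eq_square field_simps)
  finally show "dev t r \<le> (r / s)\<^sup>2 * dev t s" unfolding dev_def .
qed

text \<open>Monotonicity reduces the claim to the endpoints, up to the increment of the mean over
  the cell. The mean is of order \<open>a\<^sup>2 * \<delta>\<close> and the cell has logarithmic
  length \<open>1 / (1 + \<delta>)\<close>, so this increment is \<open>O(a\<^sup>2)\<close>, which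
  \<open>dev\<close> absorbs since \<open>t \<ge> 1\<close>.\<close>

lemma process_interpolate:
  assumes H: "H \<in> processes" and t: "1 \<le> t" and a: "0 < a" and r: "a \<le> \<sigma>" "\<sigma> \<le> b" "b = a * exp (1 / (1 + \<delta>))"
    and ca: "\<bar>H a h - EE H a\<bar> \<le> 20 * dev t a" and cb: "\<bar>H b h - EE H b\<bar> \<le> 20 * dev t b"
  shows "\<bar>H \<sigma> h - EE H \<sigma>\<bar> \<le> 250 * dev t \<sigma>"
proof -
  define \<eta> where "\<eta> = 1 / (1 + \<delta>)"
  have \<delta>: "0 \<le> \<delta>" by (rule tc.stat_dim_nonneg)
  then have \<eta>: "0 < \<eta>" "\<eta> \<le> 1" "\<eta> * \<delta> \<le> 1" by (auto simp: \<eta>_def divide_le_eq)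
  have pos: "0 < \<sigma>" "0 < b" using a r by auto
  have q: "b / a = exp \<eta>" using a r(3) by (simp add: \<eta>_def)
  have "exp \<eta> \<le> exp 1" using \<eta> by simp
  then have q3: "exp \<eta> \<le> 3" using exp_le by linarith
  have q2: "(exp \<eta>)\<^sup>2 \<le> 9" using power_mono[OF q3, of 2] by simp
  \<comment> \<open>Bounds \<open>exp (2 * \<eta>) - 1\<close> linearly in \<open>\<eta>\<close> by
    factoring out \<open>exp (2 * \<eta>)\<close>, which is at most 9.\<close>
  have "1 - exp (- (2 * \<eta>)) \<le> 2 * \<eta>" using exp_ge_add_one_self[of "- (2 * \<eta>)"] by simp
  then have "(exp \<eta>)\<^sup>2 * (1 - exp (- (2 * \<eta>))) \<le> 9 * (2 * \<eta>)" using q2 \<eta> by (intro mult_mono) auto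
  then have inc: "(exp \<eta>)\<^sup>2 - 1 \<le> 18 * \<eta>" by (simp add: exp_double[symmetric] right_diff_distrib flip: exp_add)
  have sw: "H a h \<le> H \<sigma> h" "H \<sigma> h \<le> H b h" using process_sandwich[OF H, of h] a r pos unfolding sandwich_def by blast+
  have swE: "EE H a \<le> EE H \<sigma>" "EE H \<sigma> \<le> EE H b" "EE H b \<le> (b / a)\<^sup>2 * EE H a" "0 \<le> EE H a"
    using EE_sandwich[OF H] a r pos unfolding sandwich_def by (blast, blast, meson order_trans, blast)
  have "EE H b - EE H a \<le> ((exp \<eta>)\<^sup>2 - 1) * EE H a" using swE(3) by (simp add: q algebra_simps)
  also have "\<dots> \<le> (18 * \<eta>) * (2 * a\<^sup>2 * \<delta>)"
    using inc swE(4) \<eta> by (intro mult_mono EE_le H a) auto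
  also have "\<dots> = 36 * a\<^sup>2 * (\<eta> * \<delta>)" by simp
  also have "\<dots> \<le> 36 * a\<^sup>2 * 1" using \<eta>(3) by (intro mult_left_mono) auto
  also have "\<dots> \<le> 36 * (\<sigma>\<^sup>2 * t)"
  proof -
    have "a\<^sup>2 * 1 \<le> \<sigma>\<^sup>2 * t" using a r t by (intro mult_mono power_mono) auto
    then show ?thesis by simp
  qed
  also have "\<dots> \<le> 36 * dev t \<sigma>"
    using pos t EE_sandwich[of "err n K \<mu>0"] by (simp add: dev_def sandwich_def)
  finally have E: "EE H b - EE H a \<le> 36 * dev t \<sigma>" .
  have da: "dev t a \<le> dev t \<sigma>" using dev_mono(1) a r t by simp
  have d0: "0 \<le> dev t \<sigma>" using pos t EE_sandwich[of "err n K \<mu>0"] by (simp add: dev_def sandwich_def)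
  have "dev t b \<le> (b / \<sigma>)\<^sup>2 * dev t \<sigma>" using dev_mono(2) pos r t by simp
  also have "\<dots> \<le> 9 * dev t \<sigma>"
  proof (intro mult_right_mono d0)
    have "b / \<sigma> \<le> b / a" using a r pos by (intro divide_left_mono) auto
    then have "(b / \<sigma>)\<^sup>2 \<le> (exp \<eta>)\<^sup>2" unfolding q using pos by (intro power_mono) auto
    then show "(b / \<sigma>)\<^sup>2 \<le> 9" using q2 by simp
  qed
  finally have db: "dev t b \<le> 9 * dev t \<sigma>" .
  \<comment> \<open>The upper deviation is at most \<open>H b h - EE H a\<close>, giving
    \<open>20 * 9 + 36\<close>; the lower one is at most \<open>EE H b - H a h\<close>, giving
    \<open>20 + 36\<close>.\<close>
  show ?thesis
    using ca cb unfolding abs_le_iff by (intro conjI) (use E da d0 db sw swE in linarith)+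
qed

text \<open>The paths, the means and \<open>dev\<close> are continuous in \<open>\<sigma>\<close>,
  so the uncountable intersection equals one over a countable dense set of levels.\<close>

lemma event_measurable:
  assumes H: "H \<in> processes" and e0: "0 < \<epsilon>0"
  shows "{h \<in> space (std_gaussian n). \<forall>\<sigma>\<in>{\<epsilon>0..M0}. \<bar>H \<sigma> h - EE H \<sigma>\<bar> \<le> c * dev t \<sigma>} \<in> sets (std_gaussian n)"
proof -
  obtain D where D: "countable D" "D \<subseteq> {\<epsilon>0..M0}" "{\<epsilon>0..M0} \<subseteq> closure D"
    using separable[of "{\<epsilon>0..M0}"] by metis
  have Dpos: "0 \<le> \<sigma>" if "\<sigma> \<in> D" for \<sigma> using D(2) that e0 by fastforce
  have clD: "closure D = {\<epsilon>0..M0}" using D by (metis closure_minimal closed_atLeastAtMost subset_antisym)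
  have sub: "{\<epsilon>0..M0} \<subseteq> {0<..}" using e0 by auto
  have cont: "continuous_on {\<epsilon>0..M0} f" if "sandwich f" for f
    by (rule continuous_on_subset[OF sandwich_continuous[OF that] sub])
  have iff: "(\<forall>\<sigma>\<in>{\<epsilon>0..M0}. \<bar>H \<sigma> h - EE H \<sigma>\<bar> \<le> c * dev t \<sigma>) \<longleftrightarrow> (\<forall>\<sigma>\<in>D. \<bar>H \<sigma> h - EE H \<sigma>\<bar> - c * dev t \<sigma> \<le> 0)" for h
  proof
    assume *: "\<forall>\<sigma>\<in>D. \<bar>H \<sigma> h - EE H \<sigma>\<bar> - c * dev t \<sigma> \<le> 0"
    have "continuous_on (closure D) (\<lambda>\<sigma>. \<bar>H \<sigma> h - EE H \<sigma>\<bar> - c * dev t \<sigma>)"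
      unfolding clD dev_def
      by (intro continuous_intros cont process_sandwich[OF H] EE_sandwich[OF H] EE_sandwich[of "err n K \<mu>0"]) simp
    then have "\<bar>H \<sigma> h - EE H \<sigma>\<bar> - c * dev t \<sigma> \<le> 0" if "\<sigma> \<in> closure D" for \<sigma>
      by (rule continuous_le_on_closure[OF _ that]) (use * in auto)
    then show "\<forall>\<sigma>\<in>{\<epsilon>0..M0}. \<bar>H \<sigma> h - EE H \<sigma>\<bar> \<le> c * dev t \<sigma>" by (simp add: clD)
  qed (use D(2) in auto)
  have [measurable]: "H \<sigma> \<in> borel_measurable (std_gaussian n)" if "\<sigma> \<in> D" for \<sigma>
    using measurable_process[OF H Dpos[OF that]] .
  show ?thesis unfolding iff using D(1) by measurable
qed

text \<open>Union bound over the geometric grid \<open>g\<close>, whose number of points is of order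
  \<open>(1 + \<delta>) * log_plus (M0 / \<epsilon>0)\<close>, followed by interpolation inside each
  cell.\<close>

lemma uniform_concentration:
  assumes H: "H \<in> processes" and e0: "0 < \<epsilon>0" "\<epsilon>0 < M0" and t: "1 \<le> t"
  shows "1 - 16 * exp (- t) * (1 + \<delta>) * log_plus (M0 / \<epsilon>0) \<le> measure (std_gaussian n)
    {h \<in> space (std_gaussian n). \<forall>\<sigma>\<in>{\<epsilon>0..M0}. \<bar>H \<sigma> h - EE H \<sigma>\<bar> \<le> 250 * dev t \<sigma>}" (is "_ \<le> measure _ ?S")
proof -
  let ?M = "std_gaussian n"
  define \<eta> where "\<eta> = 1 / (1 + \<delta>)"
  have \<delta>: "0 \<le> \<delta>" by (rule tc.stat_dim_nonneg)
  then have \<eta>: "0 < \<eta>" by (simp add: \<eta>_def)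
  define g where "g i = \<epsilon>0 * exp (real i * \<eta>)" for i
  have g: "0 < g i" for i using e0 by (simp add: g_def)
  have g_Suc: "g (Suc i) = g i * exp (1 / (1 + \<delta>))" for i
    by (simp add: g_def \<eta>_def[symmetric] distrib_right exp_add)
  define N where "N = nat \<lfloor>ln (M0 / \<epsilon>0) / \<eta>\<rfloor>"
  have lpos: "0 < ln (M0 / \<epsilon>0)" using e0 by simp
  have "\<forall>i. \<exists>B. B \<in> sets ?M \<and> measure ?M B \<le> 4 * exp (- t) \<and>
      (\<forall>h. h \<in> space ?M \<longrightarrow> h \<notin> B \<longrightarrow> \<bar>H (g i) h - EE H (g i)\<bar> \<le> 20 * dev t (g i))"
    using concentration_at[OF g t] H by metis
  then obtain B where B: "\<And>i. B i \<in> sets ?M" "\<And>i. measure ?M (B i) \<le> 4 * exp (- t)"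
    "\<And>i h. h \<in> space ?M \<Longrightarrow> h \<notin> B i \<Longrightarrow> \<bar>H (g i) h - EE H (g i)\<bar> \<le> 20 * dev t (g i)"
    by metis
  \<comment> \<open>The index \<open>Suc N\<close> supplies the right endpoint of the cell
    containing \<open>M0\<close>, so there are \<open>N + 2\<close> grid points.\<close>
  define A where "A = (\<Union>i\<le>Suc N. B i)"
  have A: "A \<in> sets ?M" using B(1) by (auto simp: A_def)
  have "measure ?M A \<le> (\<Sum>i\<le>Suc N. measure ?M (B i))" unfolding A_def
    using B(1) by (intro measure_UNION_le) auto
  also have "\<dots> \<le> (\<Sum>i\<le>Suc N. 4 * exp (- t))" by (intro sum_mono B(2))
  also have "\<dots> = real (N + 2) * (4 * exp (- t))" by simp
  also have "\<dots> \<le> (4 * ((1 + \<delta>) * log_plus (M0 / \<epsilon>0))) * (4 * exp (- t))"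
  proof (intro mult_right_mono)
    have "real N \<le> ln (M0 / \<epsilon>0) / \<eta>" unfolding N_def using lpos \<eta> by (intro of_nat_floor) simp
    also have "\<dots> = (1 + \<delta>) * ln (M0 / \<epsilon>0)" by (simp add: \<eta>_def)
    also have "\<dots> \<le> (1 + \<delta>) * log_plus (M0 / \<epsilon>0)" using \<delta> by (intro mult_left_mono) (auto simp: log_plus_def)
    finally have "real N \<le> (1 + \<delta>) * log_plus (M0 / \<epsilon>0)" .
    \<comment> \<open>Truncating the logarithm at 1 lets the product absorb the two extra grid
      points.\<close>
    moreover have "1 * 1 \<le> (1 + \<delta>) * log_plus (M0 / \<epsilon>0)" using \<delta> by (intro mult_mono) (auto simp: log_plus_def)
    ultimately show "real (N + 2) \<le> 4 * ((1 + \<delta>) * log_plus (M0 / \<epsilon>0))" by simp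
  qed simp
  finally have mA: "measure ?M A \<le> 16 * exp (- t) * (1 + \<delta>) * log_plus (M0 / \<epsilon>0)" by (simp add: mult_ac)
  have "space ?M - A \<subseteq> ?S"
  proof safe
    fix h \<sigma> assume h: "h \<in> space ?M" "h \<notin> A" and \<sigma>: "\<sigma> \<in> {\<epsilon>0..M0}"
    define i where "i = nat \<lfloor>ln (\<sigma> / \<epsilon>0) / \<eta>\<rfloor>"
    have s: "0 < \<sigma>" "1 \<le> \<sigma> / \<epsilon>0" using \<sigma> e0 by auto
    have z: "0 \<le> ln (\<sigma> / \<epsilon>0) / \<eta>" using s \<eta> by simp
    have "ln (\<sigma> / \<epsilon>0) / \<eta> \<le> ln (M0 / \<epsilon>0) / \<eta>"
      using \<sigma> e0 \<eta> s by (intro divide_right_mono ln_mono divide_right_mono) auto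
    then have iN: "i \<le> N" unfolding i_def N_def by (intro nat_mono floor_mono)
    have "real i \<le> ln (\<sigma> / \<epsilon>0) / \<eta>" unfolding i_def by (rule of_nat_floor[OF z])
    then have "real i * \<eta> \<le> ln (\<sigma> / \<epsilon>0)" using \<eta> by (simp add: pos_le_divide_eq)
    then have "exp (real i * \<eta>) \<le> \<sigma> / \<epsilon>0" using s by (simp add: ln_ge_iff)
    then have lo: "g i \<le> \<sigma>" using e0 by (simp add: g_def pos_le_divide_eq mult.commute)
    have "ln (\<sigma> / \<epsilon>0) / \<eta> < real (Suc i)" unfolding i_def using z by linarith
    then have "ln (\<sigma> / \<epsilon>0) < real (Suc i) * \<eta>" using \<eta> by (simp only: pos_divide_less_eq)
    then have "\<sigma> / \<epsilon>0 < exp (real (Suc i) * \<eta>)" using s e0 by (metis divide_pos_pos exp_less_mono exp_ln)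
    then have hi: "\<sigma> \<le> g (Suc i)" using e0 by (simp only: g_def pos_divide_less_eq) (simp add: mult.commute)
    have "h \<notin> B i" "h \<notin> B (Suc i)" using h(2) iN by (auto simp: A_def)
    with h(1) show "\<bar>H \<sigma> h - EE H \<sigma>\<bar> \<le> 250 * dev t \<sigma>"
      by (intro process_interpolate[OF H t g lo hi g_Suc] B(3))
  qed
  then have "measure ?M (space ?M - A) \<le> measure ?M ?S"
    by (intro gauss.finite_measure_mono event_measurable H e0)
  then show ?thesis using mA gauss.prob_compl[OF A] by simp
qed

end

theorem proposition4p9:
  "\<exists>C::real. C > 0 \<and>
     (\<forall>(n::nat) (K :: (nat \<Rightarrow> real) set) (\<mu>0 :: nat \<Rightarrow> real)
        (H :: real \<Rightarrow> (nat \<Rightarrow> real) \<Rightarrow> real) (\<epsilon>0::real) (M0::real) (t::real).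
        n \<ge> 1 \<longrightarrow> closedin (euclid_top n) K \<longrightarrow> vconvex n K \<longrightarrow> \<mu>0 \<in> K \<longrightarrow>
        H \<in> {err n K \<mu>0, lrt n K \<mu>0, dof n K \<mu>0} \<longrightarrow>
        0 < \<epsilon>0 \<longrightarrow> \<epsilon>0 < M0 \<longrightarrow> t \<ge> 1 \<longrightarrow>
        measure (std_gaussian n)
            {h \<in> space (std_gaussian n). \<forall>\<sigma>\<in>{\<epsilon>0..M0}.
               \<bar>H \<sigma> h - (\<integral>g. H \<sigma> g \<partial>std_gaussian n)\<bar>
                 \<le> C * (\<sigma> * sqrt (\<integral>g. err n K \<mu>0 \<sigma> g \<partial>std_gaussian n) * sqrt t + \<sigma>\<^sup>2 * t)}
          \<ge> 1 - C * exp (- t / C) * (1 + stat_dim n (tangent_cone n K \<mu>0)) * log_plus (M0 / \<epsilon>0)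
        \<and> 1 - C * exp (- t / C) * (1 + stat_dim n (tangent_cone n K \<mu>0)) * log_plus (M0 / \<epsilon>0)
          \<ge> 1 - 2 * C * exp (- t / C) * real n * log_plus (M0 / \<epsilon>0))"
\<comment> \<open>250 is the interpolation constant; it also exceeds the factor 16 of the union
  bound, and \<open>exp (- t) \<le> exp (- t / 250)\<close>.\<close>
proof (intro exI[of _ 250] conjI allI impI)
  fix n :: nat and K :: "(nat \<Rightarrow> real) set" and \<mu>0 :: "nat \<Rightarrow> real"
    and H :: "real \<Rightarrow> (nat \<Rightarrow> real) \<Rightarrow> real" and \<epsilon>0 M0 t :: real
  assume n: "n \<ge> 1" and K: "closedin (euclid_top n) K" "vconvex n K" "\<mu>0 \<in> K"
    and H: "H \<in> {err n K \<mu>0, lrt n K \<mu>0, dof n K \<mu>0}"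
    and e0: "0 < \<epsilon>0" "\<epsilon>0 < M0" and t: "t \<ge> 1"
  interpret projection_process n K \<mu>0 by unfold_locales (fact K)+
  have lp: "1 \<le> log_plus (M0 / \<epsilon>0)" by (simp add: log_plus_def)
  have \<delta>: "0 \<le> \<delta>" "\<delta> \<le> real n" using tc.stat_dim_nonneg tc.stat_dim_le by auto
  have "exp (- t) \<le> exp (- t / 250)" using t by simp
  then have "16 * exp (- t) * (1 + \<delta>) * log_plus (M0 / \<epsilon>0) \<le> 250 * exp (- t / 250) * (1 + \<delta>) * log_plus (M0 / \<epsilon>0)"
    using lp \<delta> by (intro mult_right_mono mult_mono) auto
  then show "1 - 250 * exp (- t / 250) * (1 + \<delta>) * log_plus (M0 / \<epsilon>0) \<le> measure (std_gaussian n)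
            {h \<in> space (std_gaussian n). \<forall>\<sigma>\<in>{\<epsilon>0..M0}.
               \<bar>H \<sigma> h - (\<integral>g. H \<sigma> g \<partial>std_gaussian n)\<bar>
                 \<le> 250 * (\<sigma> * sqrt (\<integral>g. err n K \<mu>0 \<sigma> g \<partial>std_gaussian n) * sqrt t + \<sigma>\<^sup>2 * t)}"
    using uniform_concentration[OF H e0 t] unfolding dev_def by linarith
  \<comment> \<open>Here \<open>1 + \<delta> \<le> 1 + real n \<le> 2 * real n\<close>, the last
    step by \<open>n \<ge> 1\<close>.\<close>
  have "250 * exp (- t / 250) * (1 + \<delta>) * log_plus (M0 / \<epsilon>0) \<le> 250 * exp (- t / 250) * (2 * real n) * log_plus (M0 / \<epsilon>0)"
    using lp \<delta> n by (intro mult_right_mono mult_left_mono) auto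
  then show "1 - 2 * 250 * exp (- t / 250) * real n * log_plus (M0 / \<epsilon>0) \<le> 1 - 250 * exp (- t / 250) * (1 + \<delta>) * log_plus (M0 / \<epsilon>0)"
    by (simp add: mult_ac)
qed simp

end
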